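(* Let $d\ge 2$. Every $d(d+1)$-connected graph is generically $C_{d-1}^{d-2}$-rigid.
   Context: Let $G=(V,E)$ be a graph and let $p:V\to\mathbb{R}^2$, $p(v)=(x_v,y_v)$, be generic (the $2|V|$ coordinates algebraically independent over $\mathbb{Q}$). The $C_{d-1}^{d-2}$-cofactor matrix has a row for each edge $uv$ and $d$ columns for each vertex; the row of $uv$ contains in the columns of $u$ the vector $D(u,v)=\big((x_u-x_v)^{d-1},(x_u-x_v)^{d-2}(y_u-y_v),\dots,(y_u-y_v)^{d-1}\big)$, in the columns of $v$ the vector $D(v,u)=-D(u,v)$ up to the sign convention $D(v,u)$ defined analogously, and zeros elsewhere. The generic $C_{d-1}^{d-2}$-cofactor matroid of the complete graph $K(V)$ is the row matroid of this matrix for $K(V)$ (independent of the generic $p$). $G$ is generically $C_{d-1}^{d-2}$-rigid if the closure of $E$ in this matroid is all of $K(V)$. *)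

theory Defs
  imports Complex_Main "HOL-Library.Poly_Mapping"
begin

definition complete_edges :: "'v set \<Rightarrow> 'v set set" where
  "complete_edges V = {e. e \<subseteq> V \<and> card e = 2}"

definition simple_graph :: "'v set \<Rightarrow> 'v set set \<Rightarrow> bool" where
  "simple_graph V E \<longleftrightarrow> finite V \<and> E \<subseteq> complete_edges V"

definition delete_vertices :: "'v set \<Rightarrow> 'v set set \<Rightarrow> 'v set set" where
  "delete_vertices S E = {e \<in> E. e \<inter> S = {}}"

definition connected_graph :: "'v set \<Rightarrow> 'v set set \<Rightarrow> bool" where
  "connected_graph V E \<longleftrightarrow> V \<noteq> {} \<and> (\<forall>u\<in>V. \<forall>v\<in>V. (u, v) \<in> {(a, b). {a, b} \<in> E}\<^sup>*)"

definition k_connected :: "nat \<Rightarrow> 'v set \<Rightarrow> 'v set set \<Rightarrow> bool" where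
  "k_connected k V E \<longleftrightarrow>
     card V \<ge> k + 1 \<and>
     (\<forall>S. S \<subseteq> V \<and> card S < k \<longrightarrow> connected_graph (V - S) (delete_vertices S E))"

text \<open>Polynomials with rational coefficients in variables indexed by \<^typ>\<open>'i\<close> are
  finitely supported maps from monomials (finitely supported exponent maps) to coefficients.\<close>

definition poly_eval :: "('i \<Rightarrow> real) \<Rightarrow> (('i \<Rightarrow>\<^sub>0 nat) \<Rightarrow>\<^sub>0 rat) \<Rightarrow> real" where
  "poly_eval a P =
     (\<Sum>m\<in>Poly_Mapping.keys P. of_rat (Poly_Mapping.lookup P m) *
        (\<Prod>i\<in>Poly_Mapping.keys m. a i ^ Poly_Mapping.lookup m i))"

definition alg_independent_over_rat :: "'i set \<Rightarrow> ('i \<Rightarrow> real) \<Rightarrow> bool" where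
  "alg_independent_over_rat I a \<longleftrightarrow>
     (\<forall>P. (\<forall>m\<in>Poly_Mapping.keys P. Poly_Mapping.keys m \<subseteq> I) \<and> poly_eval a P = 0 \<longrightarrow> P = 0)"

text \<open>The index set is the disjoint sum of two copies of the vertex set, one for the
  x-coordinates and one for the y-coordinates.\<close>

definition generic_placement :: "'v set \<Rightarrow> ('v \<Rightarrow> real \<times> real) \<Rightarrow> bool" where
  "generic_placement V p \<longleftrightarrow>
     alg_independent_over_rat (V <+> V) (case_sum (\<lambda>v. fst (p v)) (\<lambda>v. snd (p v)))"

definition rows_independent :: "('r \<Rightarrow> 'c \<Rightarrow> real) \<Rightarrow> 'c set \<Rightarrow> 'r set \<Rightarrow> bool" where
  "rows_independent A C F \<longleftrightarrow>
     (\<forall>t. (\<forall>j\<in>C. (\<Sum>i\<in>F. t i * A i j) = 0) \<longrightarrow> (\<forall>i\<in>F. t i = 0))"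

text \<open>Rank and closure are meant for matroids with a finite ground set.\<close>

definition matroid_rank :: "('r set \<Rightarrow> bool) \<Rightarrow> 'r set \<Rightarrow> nat" where
  "matroid_rank indep F = Max (card ` {I. I \<subseteq> F \<and> indep I})"

definition matroid_closure :: "'r set \<Rightarrow> ('r set \<Rightarrow> bool) \<Rightarrow> 'r set \<Rightarrow> 'r set" where
  "matroid_closure ground indep F =
     {e \<in> ground. matroid_rank indep (insert e F) = matroid_rank indep F}"

definition cofactor_vec :: "nat \<Rightarrow> ('v \<Rightarrow> real \<times> real) \<Rightarrow> 'v \<Rightarrow> 'v \<Rightarrow> nat \<Rightarrow> real" where
  "cofactor_vec d p u v i =
     (fst (p u) - fst (p v)) ^ (d - 1 - i) * (snd (p u) - snd (p v)) ^ i"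

definition oriented_cofactor_row ::
    "nat \<Rightarrow> ('v \<Rightarrow> real \<times> real) \<Rightarrow> 'v \<Rightarrow> 'v \<Rightarrow> 'v \<times> nat \<Rightarrow> real" where
  "oriented_cofactor_row d p u v = (\<lambda>(w, i).
     if w = u then cofactor_vec d p u v i
     else if w = v then - cofactor_vec d p u v i
     else 0)"

text \<open>The two orientations of an edge give the same row up to sign, so the row matroid does
  not depend on which endpoint is chosen as the tail in the definition of the matrix below.\<close>

lemma oriented_cofactor_row_swap:
  assumes "u \<noteq> v" and "i < d"
  shows "oriented_cofactor_row d p v u (w, i) = (-1) ^ d * oriented_cofactor_row d p u v (w, i)"
proof -
  define a b where "a = fst (p u) - fst (p v)" and "b = snd (p u) - snd (p v)"
  have ab: "fst (p v) - fst (p u) = - a" "snd (p v) - snd (p u) = - b"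
    by (simp_all add: a_def b_def)
  have "cofactor_vec d p v u i = (-1) ^ (d - 1 - i) * (-1) ^ i * (a ^ (d - 1 - i) * b ^ i)"
    unfolding cofactor_vec_def ab power_minus[of a] power_minus[of b] by (simp add: mult_ac)
  also have "(-1) ^ (d - 1 - i) * (-1) ^ i = ((-1) ^ (d - 1) :: real)"
    using assms(2) by (simp flip: power_add)
  also have "\<dots> = - ((-1) ^ d)"
    using assms(2) by (cases d) simp_all
  finally have "cofactor_vec d p v u i = - ((-1) ^ d) * cofactor_vec d p u v i"
    by (simp add: cofactor_vec_def a_def b_def)
  then show ?thesis
    using assms(1) by (auto simp: oriented_cofactor_row_def)
qed

definition cofactor_matrix ::
    "nat \<Rightarrow> ('v \<Rightarrow> real \<times> real) \<Rightarrow> 'v set \<Rightarrow> 'v \<times> nat \<Rightarrow> real" where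
  "cofactor_matrix d p e =
     (let u = (SOME u. u \<in> e); v = (SOME v. v \<in> e - {u}) in oriented_cofactor_row d p u v)"

definition cofactor_indep ::
    "nat \<Rightarrow> ('v \<Rightarrow> real \<times> real) \<Rightarrow> 'v set \<Rightarrow> 'v set set \<Rightarrow> bool" where
  "cofactor_indep d p V F \<longleftrightarrow>
     F \<subseteq> complete_edges V \<and> rows_independent (cofactor_matrix d p) (V \<times> {..<d}) F"

definition generically_cofactor_rigid :: "nat \<Rightarrow> 'v set \<Rightarrow> 'v set set \<Rightarrow> bool" where
  "generically_cofactor_rigid d V E \<longleftrightarrow>
     (\<forall>p. generic_placement V p \<longrightarrow>
        matroid_closure (complete_edges V) (cofactor_indep d p V) E = complete_edges V)"

end

theory Submission
  imports Defs "HOL-Computational_Algebra.Polynomial"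
begin

text \<open>
  Replace \<open>E\<close> by its closure and suppose that it is not complete. An explicit stress of the complete
  graph on \<open>d + 2\<close> points shows that cliques of \<open>E\<close> sharing \<open>d\<close> vertices have a union which is again
  a clique. A vertex whose neighbourhood is a clique can be deleted, so in a smallest counterexample
  there is none.

  Add the vertices in a uniformly random order. A vertex with \<open>b\<close> neighbours among its predecessors
  raises the rank by at least \<open>min d b\<close> (0-extension), and by at least \<open>d + 1\<close> if \<open>b > d\<close> and these
  neighbours do not form a clique (1-extension). For a vertex of degree \<open>D\<close>, the number \<open>b\<close> is uniform
  on \<open>{0..D}\<close>, and by the gluing property at most \<open>(D - 1) choose b\<close> of the \<open>b\<close>-subsets of the
  neighbourhood are cliques. Hence the expected increment is at least \<open>d\<close> as soon as
  \<open>D \<ge> d (d + 1)\<close>, and the rank would be at least \<open>d |V|\<close>, which is impossible.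
\<close>

section \<open>Averaging over vertex orderings\<close>

text \<open>The constant \<open>d * (d + 1)\<close> is where a loss and a gain balance. For degree
  \<open>D\<close>, the positions \<open>b < d\<close> lose
  \<open>1 + 2 + ... + d = d * (d + 1) / 2\<close> in total, measured against an increment of
  \<open>d\<close> at each of the \<open>D + 1\<close> positions. A \<open>b\<close>-subset with
  \<open>b > d\<close> gains 1 unless it is a clique, and since
  \<open>1 - ((D - 1) choose b) / (D choose b) = b / D\<close>, the total gain is at least
  \<open>(D * (D + 1) - d * (d + 1)) / (2 * D)\<close>. This covers the loss exactly when
  \<open>D >= d * (d + 1)\<close>. At the boundary the average leaves no surplus, so the
  contradiction needs the rank to stay strictly below \<open>d * |V|\<close>, which translations
  guarantee.

  The obstacle is that neighbours forming a clique offer no gain. Gluing answers it twice: it limits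
  the cliques inside a neighbourhood, and it restores a vertex that was deleted because its whole
  neighbourhood is a clique. A bound on the minimum degree need not survive such a deletion, whereas
  connectivity does; hence the induction carries connectivity.\<close>

text \<open>The extremal family consists of all subsets of \<open>X - {w}\<close> for one point
  \<open>w\<close>. If \<open>X - {w}\<close> itself belongs to \<open>K\<close>, gluing forces
  every member of size \<open>s\<close> into it. Otherwise \<open>K\<close> is split at a point
  \<open>w\<close>: the members through \<open>w\<close>, with \<open>w\<close> removed, glue
  already along \<open>n\<close> points, the members avoiding \<open>w\<close> live on the smaller
  ground set \<open>X - {w}\<close>, and Pascal's rule adds the two bounds. This explains the nested
  induction on \<open>n\<close> and on \<open>X\<close>.\<close>

lemma card_glued_family_le:
  assumes "finite X" and "X \<notin> K" and "\<And>A. A \<in> K \<Longrightarrow> A \<subseteq> X"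
    and "\<And>A B. \<lbrakk>A \<in> K; B \<in> K; n \<le> card (A \<inter> B)\<rbrakk> \<Longrightarrow> A \<union> B \<in> K"
    and "n < s"
  shows "card {A \<in> K. card A = s} \<le> (card X - 1) choose s"
  using assms
proof (induction n arbitrary: X K s)
  case 0
  show ?case
  proof (cases "K = {}")
    case False
    have "finite K"
      using 0(1,3) by (meson PowI finite_Pow_iff finite_subset subsetI)
    have "\<Union>L \<in> K" if "finite L" "L \<noteq> {}" "L \<subseteq> K" for L
      using that by (induction rule: finite_ne_induct) (auto intro: 0(4))
    from this[OF \<open>finite K\<close> False] have "\<Union>K \<in> K" by simp
    then have "\<Union>K \<subset> X"
      using 0(2,3) by (metis psubsetI)
    then obtain w where w: "w \<in> X" "w \<notin> \<Union>K" by blast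
    have "card {A \<in> K. card A = s} \<le> card {A. A \<subseteq> X - {w} \<and> card A = s}"
      using 0(1,3) w by (intro card_mono) auto
    then show ?thesis
      using n_subsets[of "X - {w}" s] 0(1) w by simp
  qed simp
next
  case (Suc n)
  note outer = Suc.IH
  from Suc.prems show ?case
  proof (induction X arbitrary: K rule: finite_psubset_induct)
    case (psubset X)
    note X = psubset.prems and fin = psubset.hyps
    show ?case
    proof (cases "\<exists>w\<in>X. X - {w} \<in> K")
      case True
      then obtain w where w: "w \<in> X" "X - {w} \<in> K" by blast
      \<comment> \<open>A member of size \<open>s\<close> through \<open>w\<close> meets
        \<open>X - {w}\<close> in \<open>s - 1\<close> points, enough to glue the two into
        \<open>X\<close>, which is not in \<open>K\<close>.\<close>
      have "A \<subseteq> X - {w}" if A: "A \<in> K" "card A = s" for A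
      proof (rule ccontr)
        assume "\<not> A \<subseteq> X - {w}"
        then have wA: "w \<in> A" and AX: "A \<subseteq> X" using X(2)[OF A(1)] by auto
        have "A \<inter> (X - {w}) = A - {w}" using AX by blast
        then have "Suc n \<le> card (A \<inter> (X - {w}))"
          using A(2) wA X(4) fin AX finite_subset by (fastforce simp: card_Diff_singleton)
        from X(3)[OF A(1) w(2) this] have "A \<union> (X - {w}) \<in> K" .
        moreover have "A \<union> (X - {w}) = X" using AX wA by blast
        ultimately show False using X(1) by simp
      qed
      then have "{A \<in> K. card A = s} \<subseteq> {A. A \<subseteq> X - {w} \<and> card A = s}" by blast
      then have "card {A \<in> K. card A = s} \<le> card {A. A \<subseteq> X - {w} \<and> card A = s}"
        using fin by (intro card_mono) auto
      then show ?thesis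
        using n_subsets[of "X - {w}" s] fin w by simp
    next
      case False
      show ?thesis
      proof (cases "X = {}")
        case True
        then have "K = {}" using X(1,2) by (metis all_not_in_conv subset_empty)
        then show ?thesis by simp
      next
        case nonempty: False
        then obtain w where w: "w \<in> X" by blast
        obtain t where t: "s = Suc t" using X(4) by (cases s) auto
        define L where "L = {A. A \<subseteq> X - {w} \<and> insert w A \<in> K}"
        define D where "D = {A \<in> K. w \<notin> A}"
        have "card {A \<in> L. card A = t} \<le> (card (X - {w}) - 1) choose t"
        proof (rule outer)
          show "X - {w} \<notin> L" using w X(1) by (auto simp: L_def insert_absorb)
          show "n < t" using X(4) t by simp
          show "A \<union> B \<in> L" if "A \<in> L" "B \<in> L" "n \<le> card (A \<inter> B)" for A B
          proof -
            have "card (insert w A \<inter> insert w B) = Suc (card (A \<inter> B))"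
              using that(1,2) fin finite_subset[of "A \<inter> B" X]
              by (subst insert_inter_insert, subst card_insert_disjoint) (auto simp: L_def)
            then have "insert w A \<union> insert w B \<in> K"
              using that by (intro X(3)) (auto simp: L_def)
            then show ?thesis using that(1,2) by (auto simp: L_def)
          qed
        qed (use fin in \<open>auto simp: L_def\<close>)
        moreover have "card {A \<in> D. card A = s} \<le> (card (X - {w}) - 1) choose s"
        proof (rule psubset.IH)
          show "X - {w} \<notin> D" using False w by (auto simp: D_def)
        qed (use X w in \<open>auto simp: D_def\<close>)
        moreover have "{A \<in> K. card A = s} = insert w ` {A \<in> L. card A = t} \<union> {A \<in> D. card A = s}"
        proof (intro set_eqI iffI)
          fix A assume A: "A \<in> {A \<in> K. card A = s}"
          then have finA: "finite A" using X(2) fin finite_subset by blast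
          show "A \<in> insert w ` {A \<in> L. card A = t} \<union> {A \<in> D. card A = s}"
          proof (cases "w \<in> A")
            case True
            then have "A = insert w (A - {w})" "A - {w} \<in> {A \<in> L. card A = t}"
              using A t X(2)[of A] finA by (auto simp: L_def insert_absorb)
            then show ?thesis by blast
          qed (use A in \<open>auto simp: D_def\<close>)
        next
          fix A assume "A \<in> insert w ` {A \<in> L. card A = t} \<union> {A \<in> D. card A = s}"
          moreover have "card (insert w B) = Suc (card B)" if "B \<in> L" for B
            using that fin finite_subset[of B X] by (subst card_insert_disjoint) (auto simp: L_def)
          ultimately show "A \<in> {A \<in> K. card A = s}"
            using t by (auto simp: L_def D_def)
        qed
        moreover have "finite {A \<in> L. card A = t}"
          using fin by (auto simp: L_def)
        ultimately have "card {A \<in> K. card A = s}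
            \<le> ((card X - 2) choose t) + ((card X - 2) choose s)"
          using w fin
          by (smt (verit) add_mono card_Diff_singleton card_Un_le card_image_le diff_diff_left
              le_trans nat_1_add_1)
        also have "\<dots> \<le> (card X - 1) choose s"
        \<comment> \<open>Pascal's rule. Truncated subtraction spoils it for
          \<open>card X = 1\<close>, but \<open>t\<close> and \<open>s\<close> are positive, so all
          three binomials are then zero.\<close>
        proof (cases "card X - 1")
          case (Suc m)
          then have "card X - 2 = m" by simp
          then show ?thesis using Suc t by simp
        next
          case 0
          then have "card X - 2 = 0" by simp
          then show ?thesis using 0 t X(4) by (cases t) simp_all
        qed
        finally show ?thesis .
      qed
    qed
  qed
qed

text \<open>The probability that, in a uniformly random ordering of \<^term>\<open>Suc m\<close> elements, the
  predecessors of a given element form a given set of size \<^term>\<open>k\<close>.\<close>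

definition predecessor_weight :: "nat \<Rightarrow> nat \<Rightarrow> real" where
  "predecessor_weight m k = fact k * fact (m - k) / fact (Suc m)"

lemma predecessor_weight_nonneg: "0 \<le> predecessor_weight m k"
  by (simp add: predecessor_weight_def)

text \<open>A further element comes either after or before the given one, and these two cases share
  the old weight.\<close>

lemma predecessor_weight_split:
  assumes "k \<le> m"
  shows "predecessor_weight (Suc m) k + predecessor_weight (Suc m) (Suc k) = predecessor_weight m k"
proof -
  have "fact (Suc m - k) = (real m - real k + 1) * fact (m - k)"
    using assms by (simp add: Suc_diff_le of_nat_diff)
  then have "fact k * fact (Suc m - k) + fact (Suc k) * fact (Suc m - Suc k)
      = (real m + 2) * (fact k * fact (m - k))"
    by (simp only: fact_Suc diff_Suc_Suc) (simp add: algebra_simps)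
  then have "predecessor_weight (Suc m) k + predecessor_weight (Suc m) (Suc k)
      = (real m + 2) * (fact k * fact (m - k)) / ((real m + 2) * fact (Suc m))"
    unfolding predecessor_weight_def add_divide_distrib[symmetric] by (simp add: algebra_simps)
  then show ?thesis
    unfolding predecessor_weight_def by (simp add: add_eq_0_iff del: fact_Suc)
qed

text \<open>The position of an element is uniform, so all the \<open>k\<close>-subsets together
  carry weight \<open>1 / (m + 1)\<close>.\<close>

lemma predecessor_weight_choose:
  assumes "k \<le> m"
  shows "predecessor_weight m k * real (m choose k) = 1 / (real m + 1)"
proof -
  have "fact k * fact (m - k) * real (m choose k) = fact m"
    using binomial_fact_lemma[OF assms] by (metis of_nat_fact of_nat_mult)
  then show ?thesis
    by (simp add: predecessor_weight_def add.commute)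
qed

lemma sum_Pow_insert:
  assumes "finite A" "x \<notin> A"
  shows "(\<Sum>U\<in>Pow (insert x A). f U) = (\<Sum>U\<in>Pow A. f U + f (insert x U))"
proof -
  have "(\<Sum>U\<in>Pow (insert x A). f U) = sum f (Pow A) + sum f (insert x ` Pow A)"
    unfolding Pow_insert using assms by (intro sum.union_disjoint) auto
  also have "sum f (insert x ` Pow A) = (\<Sum>U\<in>Pow A. f (insert x U))"
    using assms by (intro sum.reindex_cong[OF _ refl refl]) (auto simp: inj_on_def)
  finally show ?thesis by (simp add: sum.distrib)
qed

text \<open>Elements outside \<open>N\<close> do not influence which elements of \<open>N\<close>
  come first. They are inserted one at a time, each step being an instance of
  \<open>predecessor_weight_split\<close>.\<close>

lemma sum_predecessor_weight_marginal:
  fixes g :: "'a set \<Rightarrow> real"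
  assumes "finite A" "N \<subseteq> A"
  shows "(\<Sum>U\<in>Pow A. predecessor_weight (card A) (card U) * g (U \<inter> N)) =
         (\<Sum>S\<in>Pow N. predecessor_weight (card N) (card S) * g S)"
proof -
  have finN: "finite N" using assms finite_subset by blast
  have "(\<Sum>U\<in>Pow (N \<union> B). predecessor_weight (card (N \<union> B)) (card U) * g (U \<inter> N)) =
         (\<Sum>S\<in>Pow N. predecessor_weight (card N) (card S) * g S)"
    if "finite B" "B \<inter> N = {}" for B
    using that
  proof (induction B rule: finite_induct)
    case empty
    then show ?case by (auto intro!: sum.cong simp: Int_absorb2)
  next
    case (insert x B)
    let ?A = "N \<union> B"
    have A: "finite ?A" "x \<notin> ?A" "x \<notin> N" using insert finN by auto
    have "(\<Sum>U\<in>Pow (insert x ?A). predecessor_weight (Suc (card ?A)) (card U) * g (U \<inter> N))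
        = (\<Sum>U\<in>Pow ?A. predecessor_weight (card ?A) (card U) * g (U \<inter> N))"
      unfolding sum_Pow_insert[OF A(1,2)]
    proof (rule sum.cong[OF refl])
      fix U assume U: "U \<in> Pow ?A"
      then have "finite U" "x \<notin> U" "card U \<le> card ?A"
        using A finite_subset by (auto intro: card_mono)
      then show "predecessor_weight (Suc (card ?A)) (card U) * g (U \<inter> N)
          + predecessor_weight (Suc (card ?A)) (card (insert x U)) * g (insert x U \<inter> N)
          = predecessor_weight (card ?A) (card U) * g (U \<inter> N)"
        using A(3) predecessor_weight_split[of "card U" "card ?A"] by (simp flip: distrib_right)
    qed
    then show ?case using insert A by simp
  qed
  from this[of "A - N"] show ?thesis
    using assms by (simp add: Un_absorb1 inf_commute)
qed

text \<open>The efficiency of the Shapley value: averaging the telescoping sum of increments over all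
  orderings.\<close>

lemma sum_shapley:
  fixes f :: "'a set \<Rightarrow> real"
  assumes "finite V" "V \<noteq> {}"
  shows "(\<Sum>v\<in>V. \<Sum>U\<in>Pow (V - {v}). predecessor_weight (card V - 1) (card U) * (f (insert v U) - f U))
    = f V - f {}"
proof -
  define n where "n = card V"
  define w where "w = predecessor_weight (n - 1)"
  \<comment> \<open>\<open>c t\<close> is the probability that the first \<open>t\<close> elements
    of an ordering form a given \<open>t\<close>-set. Each \<open>T\<close> collects weight
    \<open>c (card T)\<close> both as \<open>insert v U\<close> and as \<open>U\<close>, except that
    \<open>{}\<close> never has the first form and \<open>V\<close> never the second; these two
    exceptions are what remains after cancellation.\<close>
  define c where "c = (\<lambda>t. fact t * fact (n - t) / fact n :: real)"
  have n: "n > 0" using assms by (simp add: n_def card_gt_0_iff)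
  have w1: "real t * w (t - 1) = (if t = 0 then 0 else c t)" if "t \<le> n" for t
  proof (cases t)
    case (Suc k)
    obtain m where m: "n = Suc m" using n by (cases n) auto
    show ?thesis
      using Suc m by (simp add: w_def c_def predecessor_weight_def mult.assoc del: of_nat_Suc)
  qed simp
  have w2: "real (n - t) * w t = (if t = n then 0 else c t)" if "t \<le> n" for t
  proof (cases "t = n")
    case False
    then have "t < n" using that by simp
    then obtain m where m: "n = Suc (t + m)" using less_imp_Suc_add by blast
    show ?thesis
      by (simp add: m w_def c_def predecessor_weight_def del: of_nat_Suc)
  qed simp
  have "(\<Sum>v\<in>V. \<Sum>U\<in>Pow (V - {v}). w (card U) * f (insert v U))
      = (\<Sum>v\<in>V. \<Sum>T\<in>{T\<in>Pow V. v \<in> T}. w (card T - 1) * f T)"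
  proof (rule sum.cong[OF refl], rule sum.reindex_bij_witness[of _ "\<lambda>T. T - {v}" "insert v" for v])
    fix v U assume "U \<in> Pow (V - {v})"
    then show "w (card (insert v U) - 1) * f (insert v U) = w (card U) * f (insert v U)"
      using assms(1) finite_subset[of U V] by (subst card_insert_disjoint) auto
  qed auto
  also have "\<dots> = (\<Sum>T\<in>Pow V. \<Sum>v\<in>{v\<in>V. v \<in> T}. w (card T - 1) * f T)"
    using assms by (intro sum.swap_restrict) auto
  also have "\<dots> = (\<Sum>T\<in>Pow V. real (card T) * w (card T - 1) * f T)"
    by (intro sum.cong) (auto simp: Int_absorb1 Collect_conj_eq)
  also have "\<dots> = (\<Sum>T\<in>Pow V. (if card T = 0 then 0 else c (card T)) * f T)"
    using assms(1) by (intro sum.cong[OF refl]) (subst w1, auto simp: n_def card_mono)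
  also have "\<dots> = (\<Sum>T\<in>Pow V. c (card T) * f T - (if T = {} then f {} else 0))"
    using assms(1) by (intro sum.cong[OF refl]) (auto simp: c_def dest: finite_subset)
  also have "\<dots> = (\<Sum>T\<in>Pow V. c (card T) * f T) - f {}"
    using assms(1) by (simp add: sum_subtractf)
  finally have 1: "(\<Sum>v\<in>V. \<Sum>U\<in>Pow (V - {v}). w (card U) * f (insert v U))
      = (\<Sum>T\<in>Pow V. c (card T) * f T) - f {}" .
  have "(\<Sum>v\<in>V. \<Sum>U\<in>Pow (V - {v}). w (card U) * f U)
      = (\<Sum>v\<in>V. \<Sum>T\<in>{T\<in>Pow V. v \<notin> T}. w (card T) * f T)"
    by (intro sum.cong) auto
  also have "\<dots> = (\<Sum>T\<in>Pow V. \<Sum>v\<in>{v\<in>V. v \<notin> T}. w (card T) * f T)"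
    using assms by (intro sum.swap_restrict) auto
  also have "\<dots> = (\<Sum>T\<in>Pow V. real (n - card T) * w (card T) * f T)"
  proof (rule sum.cong[OF refl])
    fix T assume T: "T \<in> Pow V"
    have "{v\<in>V. v \<notin> T} = V - T" by blast
    then show "(\<Sum>v\<in>{v\<in>V. v \<notin> T}. w (card T) * f T) = real (n - card T) * w (card T) * f T"
      using T assms(1) by (simp add: card_Diff_subset finite_subset n_def)
  qed
  also have "\<dots> = (\<Sum>T\<in>Pow V. (if card T = n then 0 else c (card T)) * f T)"
    using assms(1) by (intro sum.cong[OF refl]) (subst w2, auto simp: n_def card_mono)
  also have "\<dots> = (\<Sum>T\<in>Pow V. c (card T) * f T - (if T = V then f V else 0))"
    using assms(1) by (intro sum.cong[OF refl]) (auto simp: c_def n_def dest: card_subset_eq)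
  also have "\<dots> = (\<Sum>T\<in>Pow V. c (card T) * f T) - f V"
    using assms(1) by (simp add: sum_subtractf)
  finally have 2: "(\<Sum>v\<in>V. \<Sum>U\<in>Pow (V - {v}). w (card U) * f U)
      = (\<Sum>T\<in>Pow V. c (card T) * f T) - f V" .
  show ?thesis
    using 1 2 by (simp add: w_def n_def right_diff_distrib sum_subtractf)
qed

lemma sum_Pow_by_card:
  assumes "finite N"
  shows "(\<Sum>S\<in>Pow N. f S) = (\<Sum>b\<le>card N. \<Sum>S\<in>{S\<in>Pow N. card S = b}. f S)"
  using assms by (intro sum.group[symmetric]) (auto intro: card_mono)

text \<open>\<open>K\<close> stands for the cliques inside the neighbourhood \<open>N\<close> of a
  vertex. Grouping the subsets by size reduces the claim to an average over \<open>b\<close> in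
  \<open>{0..D}\<close>, in which each size counts equally.\<close>

lemma average_increment_ge:
  assumes "finite N" and "d \<ge> 1" and D: "card N \<ge> d * (d + 1)"
    and "N \<notin> K" and "\<And>A. A \<in> K \<Longrightarrow> A \<subseteq> N"
    and "\<And>A B. \<lbrakk>A \<in> K; B \<in> K; d - 1 \<le> card (A \<inter> B)\<rbrakk> \<Longrightarrow> A \<union> B \<in> K"
  shows "real d \<le> (\<Sum>S\<in>Pow N. predecessor_weight (card N) (card S) *
           (real (min d (card S)) + (if d < card S \<and> S \<notin> K then 1 else 0)))"
proof -
  define D where "D = card N"
  have Dpos: "D > 0" and dD: "d \<le> D" and Dd: "D \<ge> d * (d + 1)"
    using assms(2,3) by (auto simp: D_def intro: order_trans[rotated])
  have "(\<Sum>b\<le>D. (real (min d b) + (if d < b then real b / real D else 0)) / (real D + 1))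
     \<le> (\<Sum>b\<le>D. \<Sum>S\<in>{S\<in>Pow N. card S = b}. predecessor_weight D (card S) *
           (real (min d (card S)) + (if d < card S \<and> S \<notin> K then 1 else 0)))"
  proof (rule sum_mono)
    fix b assume b: "b \<in> {..D}"
    define P where "P = {S\<in>Pow N. card S = b}"
    have finP: "finite P" using assms(1) by (simp add: P_def)
    have cP: "card P = D choose b" using n_subsets[OF assms(1), of b] by (simp add: P_def D_def)
    have eq: "(\<Sum>S\<in>P. predecessor_weight D (card S) *
           (real (min d (card S)) + (if d < card S \<and> S \<notin> K then 1 else 0)))
       = predecessor_weight D b * (real (D choose b) * real (min d b)
           + (\<Sum>S\<in>P. if d < b \<and> S \<notin> K then 1 else 0))"
    proof -
      have "(\<Sum>S\<in>P. predecessor_weight D (card S) *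
           (real (min d (card S)) + (if d < card S \<and> S \<notin> K then 1 else 0)))
         = (\<Sum>S\<in>P. predecessor_weight D b *
           (real (min d b) + (if d < b \<and> S \<notin> K then 1 else 0)))"
        by (intro sum.cong) (auto simp: P_def)
      then show ?thesis by (simp add: sum_distrib_left[symmetric] sum.distrib cP)
    qed
    \<comment> \<open>At least \<open>(D choose b) - ((D - 1) choose b)\<close> of the
      \<open>b\<close>-subsets lie outside \<open>K\<close>, and this number is the fraction
      \<open>b / D\<close> of all of them.\<close>
    have "real (D choose b) * (if d < b then real b / real D else 0)
       \<le> (\<Sum>S\<in>P. if d < b \<and> S \<notin> K then 1 else 0)"
    proof (cases "d < b")
      case True
      obtain b' where b': "b = Suc b'" using True by (cases b) auto
      obtain D' where D': "D = Suc D'" using Dpos by (cases D) auto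
      have "(\<Sum>S\<in>P. if d < b \<and> S \<notin> K then 1 else 0 :: real) = real (card (P - K))"
        using True finP by (simp add: sum.If_cases Diff_eq flip: Compl_eq)
      moreover have "card P = card (P \<inter> K) + card (P - K)"
        using finP by (metis card_Int_Diff)
      moreover have "card {A \<in> K. card A = b} \<le> (D - 1) choose b"
        unfolding D_def using True by (intro card_glued_family_le[where n = "d - 1"] assms) auto
      moreover have "{A \<in> K. card A = b} = P \<inter> K"
        using assms(5) by (auto simp: P_def)
      ultimately have "real (D choose b) - real ((D - 1) choose b)
          \<le> (\<Sum>S\<in>P. if d < b \<and> S \<notin> K then 1 else 0)"
        using cP by simp
      moreover have "real (D choose b) - real ((D - 1) choose b) = real (D' choose b')"
        by (simp add: b' D')
      moreover have "real b * real (D choose b) = real D * real (D' choose b')"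
        unfolding b' D' using binomial_absorption[of b' "Suc D'"] by (metis diff_Suc_1 of_nat_mult)
      ultimately show ?thesis using True Dpos by (simp add: field_simps)
    qed (auto intro: sum_nonneg)
    then have "predecessor_weight D b * (real (D choose b) *
         (real (min d b) + (if d < b then real b / real D else 0)))
       \<le> (\<Sum>S\<in>P. predecessor_weight D (card S) *
           (real (min d (card S)) + (if d < card S \<and> S \<notin> K then 1 else 0)))"
      unfolding eq by (intro mult_left_mono predecessor_weight_nonneg) (simp add: distrib_left)
    moreover have "predecessor_weight D b * (real (D choose b) * x) = x / (real D + 1)" for x
      using predecessor_weight_choose[of b D] b by (simp add: mult.assoc[symmetric])
    ultimately show "(real (min d b) + (if d < b then real b / real D else 0)) / (real D + 1)
      \<le> (\<Sum>S\<in>{S\<in>Pow N. card S = b}. predecessor_weight D (card S) *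
           (real (min d (card S)) + (if d < card S \<and> S \<notin> K then 1 else 0)))"
      by (simp add: P_def)
  qed
  also have "\<dots> = (\<Sum>S\<in>Pow N. predecessor_weight (card N) (card S) *
           (real (min d (card S)) + (if d < card S \<and> S \<notin> K then 1 else 0)))"
    unfolding D_def sum_Pow_by_card[OF assms(1)] ..
  finally have le: "(\<Sum>b\<le>D. (real (min d b) + (if d < b then real b / real D else 0)) / (real D + 1)) \<le> \<dots>" .
  have sums: "(\<Sum>b\<le>m. real (min d b)) = real d * (real d + 1) / 2 + real d * (real m - real d)"
       "(\<Sum>b\<le>m. if d < b then real b else 0) = (real m * (real m + 1) - real d * (real d + 1)) / 2"
    if "d \<le> m" for m
    using that
  proof (induction m rule: dec_induct)
    case base
    have "(\<Sum>b\<le>d. real (min d b)) = (\<Sum>b\<le>d. real b)" by (intro sum.cong) auto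
    moreover have "(\<Sum>b\<le>k. real b) = real k * (real k + 1) / 2" for k
      by (induction k) (auto simp: field_simps)
    ultimately show "(\<Sum>b\<le>d. real (min d b)) = real d * (real d + 1) / 2 + real d * (real d - real d)"
      by simp
    show "(\<Sum>b\<le>d. if d < b then real b else 0) = (real d * (real d + 1) - real d * (real d + 1)) / 2"
      by simp
  qed (auto simp: field_simps)
  have "(\<Sum>b\<le>D. (real (min d b) + (if d < b then real b / real D else 0)) / (real D + 1))
      = ((\<Sum>b\<le>D. real (min d b)) + (\<Sum>b\<le>D. if d < b then real b else 0) / real D) / (real D + 1)"
    by (simp add: sum_divide_distrib[symmetric] sum.distrib if_distrib[of "\<lambda>x. x / real D"]
          flip: sum_divide_distrib)
       (auto simp: sum_divide_distrib intro!: sum.cong)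
  also have "\<dots> \<ge> real d"
  proof -
    define x y where "x = real D" and "y = real d * (real d + 1)"
    have "real (d * (d + 1)) \<le> real D" using Dd by (rule of_nat_mono)
    then have x: "x > 0" "x \<ge> y" using Dpos by (auto simp: x_def y_def algebra_simps)
    have "real d * (x + 1) \<le> y / 2 + real d * (x - real d) + (x * (x + 1) - y) / 2 / x"
    proof -
      \<comment> \<open>Cleared of its denominator \<open>2 * x\<close>, the inequality that follows
        is exactly this product; \<open>x >= y\<close> is the degree bound.\<close>
      have "(x + 1) * (x - y) \<ge> 0" using x by simp
      then have "y / 2 \<le> (x * (x + 1) - y) / 2 / x"
        using x by (simp add: field_simps)
      moreover have "real d * (x + 1) = y + real d * (x - real d)" by (simp add: y_def algebra_simps)
      ultimately show ?thesis by linarith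
    qed
    then show ?thesis
      unfolding sums[OF dD] using x(1) by (simp add: x_def y_def pos_le_divide_eq)
  qed
  finally show ?thesis using le by linarith
qed

section \<open>Linear algebra\<close>

lemma rows_independent_subset:
  assumes "finite F" "G \<subseteq> F" "rows_independent A C F"
  shows "rows_independent A C G"
  unfolding rows_independent_def
proof (intro allI impI)
  fix t assume t: "\<forall>j\<in>C. (\<Sum>i\<in>G. t i * A i j) = 0"
  have "(\<Sum>i\<in>F. (if i \<in> G then t i else 0) * A i j) = (\<Sum>i\<in>G. t i * A i j)" for j
    using assms(1,2) by (intro sum.mono_neutral_cong_right) auto
  then have "\<forall>i\<in>F. (if i \<in> G then t i else 0) = 0"
    using t assms(3)[unfolded rows_independent_def, rule_format, of "\<lambda>i. if i \<in> G then t i else 0"]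
    by simp
  then show "\<forall>i\<in>G. t i = 0" using assms(2) by (auto split: if_splits)
qed

lemma rows_independent_cong:
  assumes "\<And>i j. \<lbrakk>i \<in> F; j \<in> C\<rbrakk> \<Longrightarrow> A i j = B i j"
  shows "rows_independent A C F \<longleftrightarrow> rows_independent B C F"
proof -
  have "(\<Sum>i\<in>F. t i * A i j) = (\<Sum>i\<in>F. t i * B i j)" if "j \<in> C" for t j
    using assms that by (intro sum.cong) auto
  then show ?thesis unfolding rows_independent_def by simp
qed

text \<open>The new rows vanish in the pivot column \<open>c\<close>. Hence in a relation between
  the old rows, column \<open>c\<close> determines the coefficient of \<open>r\<close> from the
  others, and conversely supplies the coefficient of \<open>r\<close> that extends a relation
  between the new rows.\<close>

lemma rows_independent_eliminate:
  assumes "finite F" "r \<in> F" "c \<in> C" "A r c \<noteq> 0"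
  shows "rows_independent A C F \<longleftrightarrow>
    rows_independent (\<lambda>i j. A r c * A i j - A i c * A r j) C (F - {r})"
proof
  assume ind: "rows_independent A C F"
  show "rows_independent (\<lambda>i j. A r c * A i j - A i c * A r j) C (F - {r})"
    unfolding rows_independent_def
  proof (intro allI impI ballI)
    fix t i
    assume t: "\<forall>j\<in>C. (\<Sum>i\<in>F - {r}. t i * (A r c * A i j - A i c * A r j)) = 0" and i: "i \<in> F - {r}"
    define t' where "t' i = (if i = r then - (\<Sum>i\<in>F - {r}. t i * A i c) else A r c * t i)" for i
    have "(\<Sum>i\<in>F. t' i * A i j) = 0" if "j \<in> C" for j
    proof -
      have "(\<Sum>i\<in>F. t' i * A i j) = t' r * A r j + (\<Sum>i\<in>F - {r}. t' i * A i j)"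
        using assms(1,2) by (rule sum.remove)
      also have "(\<Sum>i\<in>F - {r}. t' i * A i j) = (\<Sum>i\<in>F - {r}. A r c * t i * A i j)"
        by (intro sum.cong) (auto simp: t'_def)
      also have "t' r * A r j + \<dots> = (\<Sum>i\<in>F - {r}. t i * (A r c * A i j - A i c * A r j))"
        by (simp add: t'_def sum_distrib_left right_diff_distrib sum_subtractf mult_ac)
      finally show ?thesis using t that by simp
    qed
    then have "t' i = 0" using ind i unfolding rows_independent_def by blast
    then show "t i = 0" using i assms(4) by (simp add: t'_def)
  qed
next
  assume ind: "rows_independent (\<lambda>i j. A r c * A i j - A i c * A r j) C (F - {r})"
  show "rows_independent A C F"
    unfolding rows_independent_def
  proof (intro allI impI)
    fix t assume t: "\<forall>j\<in>C. (\<Sum>i\<in>F. t i * A i j) = 0"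
    have eq: "(\<Sum>i\<in>F - {r}. t i * A i j) = - (t r * A r j)" if "j \<in> C" for j
      using sum.remove[OF assms(1,2), of "\<lambda>i. t i * A i j"] t that by simp
    have "(\<Sum>i\<in>F - {r}. t i * (A r c * A i j - A i c * A r j)) = 0" if "j \<in> C" for j
    proof -
      have "(\<Sum>i\<in>F - {r}. t i * (A r c * A i j - A i c * A r j))
         = A r c * (\<Sum>i\<in>F - {r}. t i * A i j) - A r j * (\<Sum>i\<in>F - {r}. t i * A i c)"
        by (simp add: sum_distrib_left right_diff_distrib sum_subtractf mult_ac)
      then show ?thesis using eq that assms(3) by simp
    qed
    then have *: "\<forall>i\<in>F - {r}. t i = 0" using ind unfolding rows_independent_def by blast
    then have "(\<Sum>i\<in>F - {r}. t i * A i c) = 0" by (intro sum.neutral) auto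
    then have "t r = 0" using eq[OF assms(3)] assms(4) by simp
    then show "\<forall>i\<in>F. t i = 0" using * by auto
  qed
qed

lemma rows_independent_nonzero_entry:
  assumes "finite F" "r \<in> F" "rows_independent A C F"
  obtains c where "c \<in> C" "A r c \<noteq> 0"
proof -
  have "rows_independent A C {r}"
    using assms by (intro rows_independent_subset[OF assms(1) _ assms(3)]) auto
  then have "(\<forall>j\<in>C. (\<Sum>i\<in>{r}. 1 * A i j) = 0) \<longrightarrow> (\<forall>i\<in>{r}. (1::real) = 0)"
    unfolding rows_independent_def by (rule spec)
  then have "\<exists>c\<in>C. A r c \<noteq> 0" by simp
  then show ?thesis using that by blast
qed

text \<open>Each elimination step removes one row and clears one column, which can then be
  dropped.\<close>

lemma rows_independent_card_le:
  assumes "finite F" "finite C" "rows_independent A C F"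
  shows "card F \<le> card C"
  using assms
proof (induction F arbitrary: A C rule: finite_induct)
  case (insert r F)
  obtain c where c: "c \<in> C" "A r c \<noteq> 0"
    using rows_independent_nonzero_entry[of "insert r F" r A C] insert by auto
  let ?B = "\<lambda>i j. A r c * A i j - A i c * A r j"
  have B: "rows_independent ?B C F"
    using rows_independent_eliminate[of "insert r F" r c C A] c insert by simp
  have "rows_independent ?B (C - {c}) F"
    unfolding rows_independent_def
  proof (intro allI impI)
    fix t assume t: "\<forall>j\<in>C - {c}. (\<Sum>i\<in>F. t i * ?B i j) = 0"
    moreover have "(\<Sum>i\<in>F. t i * ?B i c) = 0" by simp
    ultimately have "\<forall>j\<in>C. (\<Sum>i\<in>F. t i * ?B i j) = 0" by blast
    then show "\<forall>i\<in>F. t i = 0" using B unfolding rows_independent_def by blast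
  qed
  then have "card F \<le> card (C - {c})" using insert by blast
  also have "\<dots> < card C" using c insert by (intro psubset_card_mono) auto
  finally show ?case using insert by simp
qed simp

text \<open>Gaussian elimination without division keeps the entries inside \<^term>\<open>R\<close>, so that a pivot
  which is nonzero at \<^term>\<open>q\<close> is also nonzero at \<^term>\<open>p\<close>.\<close>

lemma rows_independent_specialization:
  assumes "finite F" and "rows_independent (\<lambda>i j. A i j q) C F"
    and "\<And>i j. \<lbrakk>i \<in> F; j \<in> C\<rbrakk> \<Longrightarrow> A i j \<in> R"
    and R: "\<And>f g h k. \<lbrakk>f \<in> R; g \<in> R; h \<in> R; k \<in> R\<rbrakk> \<Longrightarrow> (\<lambda>x. f x * g x - h x * k x) \<in> R"
    and pq: "\<And>f. \<lbrakk>f \<in> R; f q \<noteq> 0\<rbrakk> \<Longrightarrow> f p \<noteq> (0::real)"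
  shows "rows_independent (\<lambda>i j. A i j p) C F"
  using assms(1-3)
proof (induction F arbitrary: A rule: finite_induct)
  case (insert r F)
  obtain c where c: "c \<in> C" "A r c q \<noteq> 0"
    using rows_independent_nonzero_entry[of "insert r F" r "\<lambda>i j. A i j q" C] insert by auto
  then have "A r c p \<noteq> 0" using insert.prems(2) pq by simp
  moreover have "rows_independent (\<lambda>i j. A r c q * A i j q - A i c q * A r j q) C F"
    using rows_independent_eliminate[of "insert r F" r c C "\<lambda>i j. A i j q"] c insert by simp
  then have "rows_independent (\<lambda>i j. A r c p * A i j p - A i c p * A r j p) C F"
    using insert.IH[of "\<lambda>i j x. A r c x * A i j x - A i c x * A r j x"] insert.prems(2) c(1) R
    by simp
  ultimately show ?case
    using rows_independent_eliminate[of "insert r F" r c C "\<lambda>i j. A i j p"] c(1) insert by simp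
qed (simp add: rows_independent_def)

section \<open>Spans of rows and matroid rank\<close>

text \<open>Closure is handled through linear combinations;
  \<open>matroid_rank_insert_spanned\<close> makes the passage to the ranks on which
  \<open>matroid_closure\<close> is based.\<close>

definition row_spanned :: "('r \<Rightarrow> 'c \<Rightarrow> real) \<Rightarrow> 'c set \<Rightarrow> 'r set \<Rightarrow> 'r \<Rightarrow> bool" where
  "row_spanned A C F e \<longleftrightarrow> (\<exists>c. \<forall>j\<in>C. A e j = (\<Sum>i\<in>F. c i * A i j))"

lemma row_spanned_in:
  assumes "finite F" "e \<in> F"
  shows "row_spanned A C F e"
  unfolding row_spanned_def
proof (intro exI[of _ "\<lambda>i. if i = e then 1 else 0"] ballI)
  fix j
  have "(\<Sum>i\<in>F. (if i = e then 1 else 0) * A i j) = (\<Sum>i\<in>F. if i = e then A i j else 0)"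
    by (intro sum.cong) auto
  then show "A e j = (\<Sum>i\<in>F. (if i = e then 1 else 0) * A i j)"
    using assms by simp
qed

lemma row_spanned_trans:
  assumes "row_spanned A C F e" "\<And>f. f \<in> F \<Longrightarrow> row_spanned A C G f"
  shows "row_spanned A C G e"
proof -
  obtain a where a: "\<And>j. j \<in> C \<Longrightarrow> A e j = (\<Sum>i\<in>F. a i * A i j)"
    using assms(1) unfolding row_spanned_def by blast
  have "\<exists>c. \<forall>j\<in>C. A f j = (\<Sum>i\<in>G. c i * A i j)" if "f \<in> F" for f
    using assms(2)[OF that] unfolding row_spanned_def .
  then obtain b where b: "\<And>f j. f \<in> F \<Longrightarrow> j \<in> C \<Longrightarrow> A f j = (\<Sum>i\<in>G. b f i * A i j)"
    by metis
  have "A e j = (\<Sum>i\<in>G. (\<Sum>f\<in>F. a f * b f i) * A i j)" if j: "j \<in> C" for j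
  proof -
    have "A e j = (\<Sum>f\<in>F. a f * (\<Sum>i\<in>G. b f i * A i j))"
      using a[OF j] b j by simp
    also have "\<dots> = (\<Sum>i\<in>G. \<Sum>f\<in>F. a f * b f i * A i j)"
      by (subst sum.swap) (simp add: sum_distrib_left mult.assoc)
    finally show ?thesis by (simp add: sum_distrib_right)
  qed
  then show ?thesis
    unfolding row_spanned_def by (intro exI[of _ "\<lambda>i. \<Sum>f\<in>F. a f * b f i"] ballI)
qed

lemma row_spanned_mono:
  assumes "finite G" "F \<subseteq> G" "row_spanned A C F e"
  shows "row_spanned A C G e"
proof (rule row_spanned_trans[OF assms(3)])
  show "row_spanned A C G f" if "f \<in> F" for f
    using assms(1,2) that by (intro row_spanned_in) auto
qed

lemma row_spanned_if_relation:
  assumes "finite F" "\<And>j. j \<in> C \<Longrightarrow> t e * A e j + (\<Sum>i\<in>F. t i * A i j) = 0" "t e \<noteq> 0"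
  shows "row_spanned A C F e"
  unfolding row_spanned_def
proof (intro exI[of _ "\<lambda>i. - t i / t e"] ballI)
  fix j assume "j \<in> C"
  from assms(2)[OF this] have "t e * A e j = - (\<Sum>i\<in>F. t i * A i j)" by linarith
  then have "A e j = - (\<Sum>i\<in>F. t i * A i j) / t e" using assms(3) by (simp add: field_simps)
  then show "A e j = (\<Sum>i\<in>F. - t i / t e * A i j)"
    by (simp add: sum_negf sum_divide_distrib)
qed

lemma rows_independent_insert:
  assumes "finite F" "I \<subseteq> F" "rows_independent A C I" "\<not> row_spanned A C F e"
  shows "rows_independent A C (insert e I)"
  unfolding rows_independent_def
proof (intro allI impI)
  fix t assume t: "\<forall>j\<in>C. (\<Sum>i\<in>insert e I. t i * A i j) = 0"
  have fin: "finite I" using assms finite_subset by blast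
  have "e \<notin> I" using assms(2,4) row_spanned_in[OF assms(1)] by (metis subsetD)
  then have rel: "\<And>j. j \<in> C \<Longrightarrow> t e * A e j + (\<Sum>i\<in>I. t i * A i j) = 0"
    using t fin by simp
  have "\<not> row_spanned A C I e" using row_spanned_mono[OF assms(1,2)] assms(4) by metis
  then have "t e = 0" using row_spanned_if_relation[of I C t e A, OF fin rel] by blast
  then have "\<forall>i\<in>I. t i = 0" using rel assms(3) unfolding rows_independent_def by simp
  then show "\<forall>i\<in>insert e I. t i = 0" using \<open>t e = 0\<close> by blast
qed

text \<open>The coefficients expressing the rows of \<open>J\<close> by those of \<open>I\<close>
  form a matrix with columns \<open>I\<close>. A relation between its rows is also one between the
  rows of \<open>J\<close>, so it has independent rows and at most \<open>card I\<close> of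
  them.\<close>

lemma card_le_of_row_spanned:
  assumes "finite I" "finite J" "rows_independent A C J" "\<And>j. j \<in> J \<Longrightarrow> row_spanned A C I j"
  shows "card J \<le> card I"
proof -
  have "\<exists>c. \<forall>j\<in>C. A f j = (\<Sum>i\<in>I. c i * A i j)" if "f \<in> J" for f
    using assms(4)[OF that] unfolding row_spanned_def .
  then obtain b where b: "\<And>f j. f \<in> J \<Longrightarrow> j \<in> C \<Longrightarrow> A f j = (\<Sum>i\<in>I. b f i * A i j)"
    by metis
  have "rows_independent b I J"
    unfolding rows_independent_def
  proof (intro allI impI)
    fix t assume t: "\<forall>i\<in>I. (\<Sum>f\<in>J. t f * b f i) = 0"
    have "(\<Sum>f\<in>J. t f * A f j) = 0" if j: "j \<in> C" for j
    proof -
      have "(\<Sum>f\<in>J. t f * A f j) = (\<Sum>f\<in>J. t f * (\<Sum>i\<in>I. b f i * A i j))"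
        using b j by simp
      also have "\<dots> = (\<Sum>i\<in>I. \<Sum>f\<in>J. t f * b f i * A i j)"
        by (subst sum.swap) (simp add: sum_distrib_left mult.assoc)
      also have "\<dots> = (\<Sum>i\<in>I. (\<Sum>f\<in>J. t f * b f i) * A i j)"
        by (simp add: sum_distrib_right)
      finally show ?thesis using t by simp
    qed
    then show "\<forall>f\<in>J. t f = 0" using assms(3) unfolding rows_independent_def by blast
  qed
  then show ?thesis using rows_independent_card_le[OF assms(2,1)] by blast
qed

lemma card_le_matroid_rank:
  assumes "finite F" "I \<subseteq> F" "indep I"
  shows "card I \<le> matroid_rank indep F"
proof -
  have "finite {I. I \<subseteq> F \<and> indep I}" using assms(1) by simp
  then show ?thesis unfolding matroid_rank_def using assms(2,3) by (intro Max_ge) simp_all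
qed

lemma matroid_rank_obtain:
  assumes "finite F" "indep {}"
  obtains I where "I \<subseteq> F" "indep I" "card I = matroid_rank indep F"
proof -
  have "matroid_rank indep F \<in> card ` {I. I \<subseteq> F \<and> indep I}"
    unfolding matroid_rank_def using assms by (intro Max_in) auto
  then show ?thesis using that by auto
qed

section \<open>Vandermonde systems and divided differences\<close>

text \<open>By linearity, vanishing moments can be tested against a polynomial whose zeros are
  chosen to isolate one or two nodes.\<close>

lemma poly_annihilated:
  fixes \<tau> s :: "'a \<Rightarrow> real"
  assumes "\<And>i. i < d \<Longrightarrow> (\<Sum>u\<in>S. s u * \<tau> u ^ i) = 0" "degree P < d"
  shows "(\<Sum>u\<in>S. s u * poly P (\<tau> u)) = 0"
proof -
  have "(\<Sum>u\<in>S. s u * poly P (\<tau> u)) = (\<Sum>u\<in>S. \<Sum>i\<le>degree P. coeff P i * (s u * \<tau> u ^ i))"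
    by (simp add: poly_altdef sum_distrib_left mult_ac)
  also have "\<dots> = (\<Sum>i\<le>degree P. coeff P i * (\<Sum>u\<in>S. s u * \<tau> u ^ i))"
    by (subst sum.swap) (simp add: sum_distrib_left)
  also have "\<dots> = 0" using assms by (intro sum.neutral) auto
  finally show ?thesis .
qed

text \<open>The factors are \<open>\<tau> k - x\<close> rather than \<open>x - \<tau> k\<close>, to
  match the denominators in \<open>divided_difference_power\<close>.\<close>

definition nodal_poly :: "('a \<Rightarrow> real) \<Rightarrow> 'a set \<Rightarrow> real poly" where
  "nodal_poly \<tau> S = (\<Prod>k\<in>S. [:\<tau> k, - 1:])"

lemma poly_nodal_poly: "poly (nodal_poly \<tau> S) x = (\<Prod>k\<in>S. \<tau> k - x)"
  by (simp add: nodal_poly_def poly_prod)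

lemma degree_nodal_poly: "finite S \<Longrightarrow> degree (nodal_poly \<tau> S) \<le> card S"
proof (induction S rule: finite_induct)
  case (insert x S)
  have "degree (nodal_poly \<tau> (insert x S)) \<le> degree [:\<tau> x, - 1:] + degree (nodal_poly \<tau> S)"
    unfolding nodal_poly_def prod.insert[OF insert(1,2)] by (rule degree_mult_le)
  then show ?case using insert by simp
qed (simp add: nodal_poly_def)

lemma vandermonde_independent:
  fixes \<tau> s :: "'a \<Rightarrow> real"
  assumes "finite S" "inj_on \<tau> S" "card S \<le> d"
    and "\<And>i. i < d \<Longrightarrow> (\<Sum>u\<in>S. s u * \<tau> u ^ i) = 0" and "u \<in> S"
  shows "s u = 0"
proof -
  let ?P = "nodal_poly \<tau> (S - {u})"
  have "degree ?P \<le> card (S - {u})" using assms(1) by (intro degree_nodal_poly) simp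
  also have "\<dots> < card S" using assms(1,5) by (intro psubset_card_mono) auto
  finally have "degree ?P < d" using assms(3) by simp
  from poly_annihilated[OF assms(4) this]
  have "(\<Sum>v\<in>S. s v * poly ?P (\<tau> v)) = 0" by simp
  also have "(\<Sum>v\<in>S. s v * poly ?P (\<tau> v)) = (\<Sum>v\<in>{u}. s v * poly ?P (\<tau> v))"
    using assms(1,5) by (intro sum.mono_neutral_right) (auto simp: poly_nodal_poly)
  also have "\<dots> = s u * poly ?P (\<tau> u)" by simp
  finally have "s u * poly ?P (\<tau> u) = 0" .
  moreover have "poly ?P (\<tau> u) \<noteq> 0"
    using assms(1,2,5) by (auto simp: poly_nodal_poly inj_on_def)
  ultimately show ?thesis by simp
qed

text \<open>Up to the sign \<open>(-1) ^ d\<close> this is the divided difference of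
  \<open>x ^ i\<close> at \<open>d + 1\<close> nodes. Counting dimensions gives some nontrivial
  relation \<open>c\<close> between the moment vectors; testing it against a polynomial that
  vanishes at all nodes but two shows that \<open>c\<close> is proportional to the reciprocals of
  the products.\<close>

lemma divided_difference_power:
  fixes \<tau> :: "'a \<Rightarrow> real"
  assumes "finite S" "inj_on \<tau> S" "card S = Suc d" "i < d"
  shows "(\<Sum>u\<in>S. \<tau> u ^ i / (\<Prod>k\<in>S - {u}. \<tau> k - \<tau> u)) = 0"
proof -
  define P where "P u = (\<Prod>k\<in>S - {u}. \<tau> k - \<tau> u)" for u
  have P: "P u \<noteq> 0" if "u \<in> S" for u
    using assms(1,2) that by (auto simp: P_def inj_on_def)
  have "\<not> rows_independent (\<lambda>u i. \<tau> u ^ i) {..<d} S"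
    using rows_independent_card_le[of S "{..<d}"] assms(1,3) by auto
  then obtain c u where c: "\<And>i. i < d \<Longrightarrow> (\<Sum>u\<in>S. c u * \<tau> u ^ i) = 0" and u: "u \<in> S" "c u \<noteq> 0"
    unfolding rows_independent_def by auto
  have eq: "c v * P v = c u * P u" if v: "v \<in> S" for v
  proof (cases "v = u")
    case False
    let ?Q = "nodal_poly \<tau> (S - {u, v})"
    have "card (S - {u, v}) < d"
      using assms(1,3,4) u v False by (simp add: card_Diff_subset)
    then have "degree ?Q < d"
      using degree_nodal_poly[of "S - {u, v}" \<tau>] assms(1) by simp
    from poly_annihilated[OF c this] have "(\<Sum>x\<in>S. c x * poly ?Q (\<tau> x)) = 0" by simp
    also have "(\<Sum>x\<in>S. c x * poly ?Q (\<tau> x)) = (\<Sum>x\<in>{u,v}. c x * poly ?Q (\<tau> x))"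
      using assms(1) u v by (intro sum.mono_neutral_right) (auto simp: poly_nodal_poly)
    finally have 0: "c u * poly ?Q (\<tau> u) + c v * poly ?Q (\<tau> v) = 0" using False by simp
    have S: "S - {u} = insert v (S - {u, v})" "S - {v} = insert u (S - {u, v})"
      using u v False by auto
    have "P u = (\<tau> v - \<tau> u) * poly ?Q (\<tau> u)" "P v = (\<tau> u - \<tau> v) * poly ?Q (\<tau> v)"
      unfolding P_def S poly_nodal_poly using assms(1) by (subst prod.insert; simp)+
    then have "c u * P u - c v * P v = (\<tau> v - \<tau> u) * (c u * poly ?Q (\<tau> u) + c v * poly ?Q (\<tau> v))"
      by (simp only:) (simp add: algebra_simps)
    then show ?thesis using 0 by simp
  qed simp
  have "(\<Sum>v\<in>S. c u * P u * (\<tau> v ^ i / P v)) = (\<Sum>v\<in>S. c v * \<tau> v ^ i)"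
    using eq P by (intro sum.cong) (auto simp: field_simps)
  then have "c u * P u * (\<Sum>v\<in>S. \<tau> v ^ i / P v) = 0"
    using c[OF assms(4)] by (simp add: sum_distrib_left)
  then show ?thesis using u P by (simp add: P_def)
qed

section \<open>Polynomials in the coordinates of a placement\<close>

definition coordinates :: "('v \<Rightarrow> real \<times> real) \<Rightarrow> 'v + 'v \<Rightarrow> real" where
  "coordinates p = case_sum (\<lambda>v. fst (p v)) (\<lambda>v. snd (p v))"

text \<open>Polynomials are treated as functions on all placements, so that they can be evaluated at
  a generic placement and at a convenient special one alike.\<close>

definition placement_polys :: "'v set \<Rightarrow> (('v \<Rightarrow> real \<times> real) \<Rightarrow> real) set" where
  "placement_polys V = {f. \<exists>P. (\<forall>m\<in>Poly_Mapping.keys P. Poly_Mapping.keys m \<subseteq> V <+> V) \<and>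
     (\<forall>p. f p = poly_eval (coordinates p) P)}"

text \<open>A polynomial vanishing at algebraically independent coordinates is the zero polynomial.
  Nonvanishing at a generic placement is therefore proved by exhibiting one placement
  \<open>q\<close>, however degenerate.\<close>

lemma generic_placement_nonzero:
  assumes "generic_placement V p" "f \<in> placement_polys V" "f q \<noteq> 0"
  shows "f p \<noteq> 0"
proof
  assume "f p = 0"
  obtain P where P: "\<forall>m\<in>Poly_Mapping.keys P. Poly_Mapping.keys m \<subseteq> V <+> V"
      "\<And>p. f p = poly_eval (coordinates p) P"
    using assms(2) by (auto simp: placement_polys_def)
  then have "P = 0"
    using assms(1) \<open>f p = 0\<close>
    unfolding generic_placement_def alg_independent_over_rat_def coordinates_def by metis
  then show False using P(2) assms(3) by (simp add: poly_eval_def)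
qed

definition monomial_eval :: "('i \<Rightarrow> real) \<Rightarrow> ('i \<Rightarrow>\<^sub>0 nat) \<Rightarrow> real" where
  "monomial_eval a m = (\<Prod>i\<in>Poly_Mapping.keys m. a i ^ Poly_Mapping.lookup m i)"

lemma monomial_eval_superset:
  assumes "finite I" "Poly_Mapping.keys m \<subseteq> I"
  shows "monomial_eval a m = (\<Prod>i\<in>I. a i ^ Poly_Mapping.lookup m i)"
  unfolding monomial_eval_def using assms
  by (intro prod.mono_neutral_left) (auto simp: in_keys_iff)

lemma monomial_eval_add: "monomial_eval a (m + n) = monomial_eval a m * monomial_eval a n"
proof -
  let ?I = "Poly_Mapping.keys m \<union> Poly_Mapping.keys n"
  have "monomial_eval a (m + n) = (\<Prod>i\<in>?I. a i ^ Poly_Mapping.lookup (m + n) i)"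
    by (intro monomial_eval_superset keys_add) simp
  also have "\<dots> = monomial_eval a m * monomial_eval a n"
    by (simp add: lookup_add power_add prod.distrib monomial_eval_superset[of ?I])
  finally show ?thesis .
qed

lemma monomial_in_placement_polys:
  assumes "Poly_Mapping.keys m \<subseteq> V <+> V"
  shows "(\<lambda>p. of_rat c * monomial_eval (coordinates p) m) \<in> placement_polys V"
  unfolding placement_polys_def using assms
  by (auto intro!: exI[of _ "Poly_Mapping.single m c"] simp: poly_eval_def monomial_eval_def
      split: if_splits)

lemma placement_polys_add:
  assumes "f \<in> placement_polys V" "g \<in> placement_polys V"
  shows "(\<lambda>p. f p + g p) \<in> placement_polys V"
proof -
  have add: "poly_eval a (P + Q) = poly_eval a P + poly_eval a Q" for a :: "'i \<Rightarrow> real" and P Q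
    unfolding poly_eval_def by (rule setsum_keys_plus_distrib) (auto simp: of_rat_add algebra_simps)
  obtain P Q where
    "\<forall>m\<in>Poly_Mapping.keys P. Poly_Mapping.keys m \<subseteq> V <+> V" "\<forall>p. f p = poly_eval (coordinates p) P"
    "\<forall>m\<in>Poly_Mapping.keys Q. Poly_Mapping.keys m \<subseteq> V <+> V" "\<forall>p. g p = poly_eval (coordinates p) Q"
    using assms by (auto simp: placement_polys_def)
  moreover from this have "\<forall>m\<in>Poly_Mapping.keys (P + Q). Poly_Mapping.keys m \<subseteq> V <+> V"
    using keys_add[of P Q] by blast
  ultimately show ?thesis
    unfolding placement_polys_def by (intro CollectI exI[of _ "P + Q"]) (simp add: add)
qed

lemma placement_polys_sum:
  assumes "\<And>i. i \<in> I \<Longrightarrow> f i \<in> placement_polys V"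
  shows "(\<lambda>p. \<Sum>i\<in>I. f i p) \<in> placement_polys V"
proof -
  have zero: "(\<lambda>p. 0) \<in> placement_polys V"
    by (auto simp: placement_polys_def poly_eval_def intro!: exI[of _ 0])
  show ?thesis
    using assms
  proof (induction I rule: infinite_finite_induct)
    case (insert x F)
    then show ?case using placement_polys_add[of "f x" V "\<lambda>p. \<Sum>i\<in>F. f i p"] by simp
  qed (simp_all add: zero)
qed

lemma placement_polys_mult:
  assumes "f \<in> placement_polys V" "g \<in> placement_polys V"
  shows "(\<lambda>p. f p * g p) \<in> placement_polys V"
proof -
  obtain P Q where
    P: "\<forall>m\<in>Poly_Mapping.keys P. Poly_Mapping.keys m \<subseteq> V <+> V" "\<And>p. f p = poly_eval (coordinates p) P" and
    Q: "\<forall>m\<in>Poly_Mapping.keys Q. Poly_Mapping.keys m \<subseteq> V <+> V" "\<And>p. g p = poly_eval (coordinates p) Q"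
    using assms by (auto simp: placement_polys_def)
  have "(\<lambda>p. f p * g p) = (\<lambda>p. \<Sum>m\<in>Poly_Mapping.keys P. \<Sum>n\<in>Poly_Mapping.keys Q.
      of_rat (Poly_Mapping.lookup P m * Poly_Mapping.lookup Q n) * monomial_eval (coordinates p) (m + n))"
    unfolding P(2) Q(2) poly_eval_def monomial_eval_def[symmetric]
    by (simp add: sum_product monomial_eval_add of_rat_mult mult.assoc mult.left_commute)
  also have "\<dots> \<in> placement_polys V"
    using P(1) Q(1)
    by (intro placement_polys_sum monomial_in_placement_polys order_trans[OF keys_add]) auto
  finally show ?thesis .
qed

lemma placement_polys_const: "(\<lambda>p. of_rat c) \<in> placement_polys V"
  using monomial_in_placement_polys[of 0 V c] by (simp add: monomial_eval_def)

lemma placement_polys_numeral: "(\<lambda>p. numeral k) \<in> placement_polys V"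
  using placement_polys_const[of "numeral k" V] by simp

lemma placement_polys_one: "(\<lambda>p. 1) \<in> placement_polys V"
  using placement_polys_const[of 1 V] by simp

lemma placement_polys_zero: "(\<lambda>p. 0) \<in> placement_polys V"
  using placement_polys_const[of 0 V] by simp

lemma placement_polys_uminus:
  assumes "f \<in> placement_polys V"
  shows "(\<lambda>p. - f p) \<in> placement_polys V"
  using placement_polys_mult[OF placement_polys_const[of "-1" V] assms] by (simp add: of_rat_minus)

lemma placement_polys_diff:
  assumes "f \<in> placement_polys V" "g \<in> placement_polys V"
  shows "(\<lambda>p. f p - g p) \<in> placement_polys V"
  using placement_polys_add[OF assms(1) placement_polys_uminus[OF assms(2)]] by simp

lemma placement_polys_power:
  assumes "f \<in> placement_polys V"
  shows "(\<lambda>p. f p ^ n) \<in> placement_polys V"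
proof (induction n)
  case (Suc n)
  then show ?case using placement_polys_mult[OF assms Suc] by simp
qed (simp add: placement_polys_one)

lemma placement_polys_coordinate:
  assumes "v \<in> V"
  shows "(\<lambda>p. fst (p v)) \<in> placement_polys V" "(\<lambda>p. snd (p v)) \<in> placement_polys V"
  using monomial_in_placement_polys[of "Poly_Mapping.single (Inl v) 1" V 1]
    monomial_in_placement_polys[of "Poly_Mapping.single (Inr v) 1" V 1] assms
  by (auto simp: monomial_eval_def coordinates_def)

lemmas placement_polys_intros = placement_polys_add placement_polys_mult placement_polys_diff
  placement_polys_uminus placement_polys_power placement_polys_coordinate placement_polys_zero
  placement_polys_one placement_polys_numeral

section \<open>Cofactor matrices at generic placements\<close>

lemma complete_edges_iff: "e \<in> complete_edges V \<longleftrightarrow> (\<exists>u\<in>V. \<exists>v\<in>V. u \<noteq> v \<and> e = {u, v})"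
  by (auto simp: complete_edges_def card_2_iff)

lemma doubleton_in_complete_edges [simp]:
  "{u, v} \<in> complete_edges V \<longleftrightarrow> u \<in> V \<and> v \<in> V \<and> u \<noteq> v"
  by (auto simp: complete_edges_def card_2_iff')

lemma complete_edges_subset_iff:
  "complete_edges A \<subseteq> E \<longleftrightarrow> (\<forall>x\<in>A. \<forall>y\<in>A. x \<noteq> y \<longrightarrow> {x, y} \<in> E)"
  unfolding subset_iff complete_edges_iff by blast

lemma finite_complete_edges: "finite V \<Longrightarrow> finite (complete_edges V)"
  by (simp add: complete_edges_def)

lemma complete_edges_mono: "A \<subseteq> B \<Longrightarrow> complete_edges A \<subseteq> complete_edges B"
  by (auto simp: complete_edges_def)

text \<open>The endpoint picked by \<open>SOME\<close> depends on the edge alone. The quantifier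
  over \<open>p\<close> therefore stands inside each alternative, as needed to see the entries as
  polynomials in \<open>p\<close> and to compare two placements.\<close>

lemma cofactor_matrix_orientation:
  assumes "u \<noteq> v"
  shows "(\<forall>p. cofactor_matrix d p {u, v} = oriented_cofactor_row d p u v) \<or>
         (\<forall>p. cofactor_matrix d p {u, v} = oriented_cofactor_row d p v u)"
proof -
  define a where "a = (SOME a. a \<in> {u, v})"
  define b where "b = (SOME b. b \<in> {u, v} - {a})"
  have "a \<in> {u, v}" unfolding a_def by (rule someI[of _ u]) simp
  moreover from this assms have "b \<in> {u, v} - {a}"
    unfolding b_def by (intro someI_ex[of "\<lambda>b. b \<in> {u, v} - {a}"]) auto
  ultimately have "a = u \<and> b = v \<or> a = v \<and> b = u" by auto
  moreover have "\<forall>p. cofactor_matrix d p {u, v} = oriented_cofactor_row d p a b"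
    by (simp add: cofactor_matrix_def a_def b_def Let_def)
  ultimately show ?thesis by auto
qed

lemma cofactor_vec_swap:
  assumes "i < d"
  shows "cofactor_vec d p v u i = - ((-1) ^ d) * cofactor_vec d p u v i"
proof (cases "u = v")
  case True
  show ?thesis
  \<comment> \<open>For \<open>d = 1\<close> the vector is constantly 1, also for coinciding points,
    because \<open>0 ^ 0 = 1\<close>.\<close>
  proof (cases "d = 1")
    case False
    then have "cofactor_vec d p v u i = 0"
      using assms True by (cases "i = 0") (auto simp: cofactor_vec_def)
    then show ?thesis using True by simp
  qed (use assms True in \<open>simp add: cofactor_vec_def\<close>)
next
  case False
  from oriented_cofactor_row_swap[OF False assms, of p v]
  show ?thesis using False by (simp add: oriented_cofactor_row_def)
qed

lemma cofactor_matrix_oriented: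
  assumes "u \<noteq> v"
  obtains \<sigma> :: real where "\<sigma> \<noteq> 0"
    "\<forall>w. \<forall>i<d. cofactor_matrix d p {u, v} (w, i) = \<sigma> * oriented_cofactor_row d p u v (w, i)"
proof -
  consider "cofactor_matrix d p {u, v} = oriented_cofactor_row d p u v"
    | "cofactor_matrix d p {u, v} = oriented_cofactor_row d p v u"
    using cofactor_matrix_orientation[OF assms] by metis
  then show ?thesis
  proof cases
    case 1
    then show ?thesis using that[of 1] by simp
  next
    case 2
    then show ?thesis using that[of "(-1) ^ d"] oriented_cofactor_row_swap[OF assms] by simp
  qed
qed

lemma cofactor_matrix_outside:
  assumes "e \<in> complete_edges V" "w \<notin> e"
  shows "cofactor_matrix d p e (w, i) = 0"
proof -
  obtain u v where e: "u \<noteq> v" "e = {u, v}" using assms(1) by (auto simp: complete_edges_iff)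
  then show ?thesis
    using cofactor_matrix_orientation[OF e(1), of d] assms(2)
    by (auto simp: oriented_cofactor_row_def)
qed

lemma cofactor_matrix_cong:
  assumes "e \<in> complete_edges V" "\<And>w. w \<in> e \<Longrightarrow> p w = q w"
  shows "cofactor_matrix d p e = cofactor_matrix d q e"
proof -
  obtain u v where e: "u \<noteq> v" "e = {u, v}" using assms(1) by (auto simp: complete_edges_iff)
  have "oriented_cofactor_row d p u v = oriented_cofactor_row d q u v"
    "oriented_cofactor_row d p v u = oriented_cofactor_row d q v u"
    using assms(2) e by (simp_all add: oriented_cofactor_row_def cofactor_vec_def fun_eq_iff)
  then show ?thesis using cofactor_matrix_orientation[OF e(1), of d] e by auto
qed

lemma cofactor_matrix_in_placement_polys:
  assumes "e \<in> complete_edges V"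
  shows "(\<lambda>p. cofactor_matrix d p e j) \<in> placement_polys V"
proof -
  obtain u v where e: "u \<noteq> v" "e = {u, v}" "u \<in> V" "v \<in> V"
    using assms(1) by (auto simp: complete_edges_iff)
  have vec: "(\<lambda>p. cofactor_vec d p a b i) \<in> placement_polys V" if "a \<in> V" "b \<in> V" for a b i
    unfolding cofactor_vec_def using that by (intro placement_polys_intros)
  have row: "(\<lambda>p. oriented_cofactor_row d p a b j) \<in> placement_polys V" if "a \<in> V" "b \<in> V" for a b
  proof (cases j)
    case (Pair w i)
    then show ?thesis
      using vec[OF that, of i] placement_polys_uminus[OF vec[OF that, of i]] placement_polys_zero
      by (cases "w = a"; cases "w = b") (simp_all add: oriented_cofactor_row_def)
  qed
  show ?thesis
    using cofactor_matrix_orientation[OF e(1), of d] row e by auto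
qed

text \<open>The entries are rational polynomials in the coordinates, so a special placement can only
  lose independence. It suffices to verify independence at any convenient \<open>q\<close>.\<close>

lemma rows_independent_generic:
  assumes "generic_placement V p" "finite V" "F \<subseteq> complete_edges V"
    and "rows_independent (cofactor_matrix d q) C F"
  shows "rows_independent (cofactor_matrix d p) C F"
proof (rule rows_independent_specialization[where R = "placement_polys V" and q = q
      and A = "\<lambda>e j p. cofactor_matrix d p e j"])
  show "finite F" using assms finite_complete_edges finite_subset by blast
  show "(\<lambda>p. cofactor_matrix d p e j) \<in> placement_polys V" if "e \<in> F" for e j
    using that assms(3) by (intro cofactor_matrix_in_placement_polys) auto
  show "(\<lambda>x. f x * g x - h x * k x) \<in> placement_polys V"
    if "f \<in> placement_polys V" "g \<in> placement_polys V" "h \<in> placement_polys V" "k \<in> placement_polys V"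
    for f g h k
    using that by (intro placement_polys_diff placement_polys_mult)
  show "f p \<noteq> 0" if "f \<in> placement_polys V" "f q \<noteq> 0" for f
    using generic_placement_nonzero[OF assms(1) that] .
qed (rule assms(4))

section \<open>The stress of the complete graph on d + 2 points\<close>

text \<open>Twice the signed area of the triangle \<open>u\<close>, \<open>v\<close>,
  \<open>w\<close>; it vanishes exactly for collinear points.\<close>

definition bracket :: "('v \<Rightarrow> real \<times> real) \<Rightarrow> 'v \<Rightarrow> 'v \<Rightarrow> 'v \<Rightarrow> real" where
  "bracket p u v w = (fst (p v) - fst (p u)) * (snd (p w) - snd (p u))
     - (fst (p w) - fst (p u)) * (snd (p v) - snd (p u))"

text \<open>Dividing by the difference of the x-coordinates makes \<open>cofactor_vec\<close> a
  multiple of the moment vector \<open>(1, s, ..., s ^ (d - 1))\<close> of the slope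
  \<open>s\<close>, so that facts about Vandermonde systems apply at each vertex.\<close>

definition slope :: "('v \<Rightarrow> real \<times> real) \<Rightarrow> 'v \<Rightarrow> 'v \<Rightarrow> real" where
  "slope p u v = (snd (p u) - snd (p v)) / (fst (p u) - fst (p v))"

lemma bracket_eq_slope:
  assumes "fst (p u) \<noteq> fst (p v)" "fst (p u) \<noteq> fst (p w)"
  shows "bracket p u v w = (fst (p u) - fst (p v)) * (fst (p u) - fst (p w)) * (slope p u w - slope p u v)"
  using assms by (simp add: bracket_def slope_def divide_simps) (simp add: algebra_simps)

lemma cofactor_vec_eq_slope:
  assumes "i < d" "fst (p u) \<noteq> fst (p v)"
  shows "cofactor_vec d p u v i = (fst (p u) - fst (p v)) ^ (d - 1) * slope p u v ^ i"
proof -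
  have "(fst (p u) - fst (p v)) ^ (d - 1) = (fst (p u) - fst (p v)) ^ (d - 1 - i) * (fst (p u) - fst (p v)) ^ i"
    using assms(1) by (simp flip: power_add)
  then show ?thesis using assms(2) by (simp add: cofactor_vec_def slope_def power_divide)
qed

lemma inj_on_slope:
  assumes "\<And>u. u \<in> S \<Longrightarrow> fst (p v) \<noteq> fst (p u)"
    and "\<And>u w. \<lbrakk>u \<in> S; w \<in> S; u \<noteq> w\<rbrakk> \<Longrightarrow> bracket p v u w \<noteq> 0"
  shows "inj_on (slope p v) S"
proof (rule inj_onI, rule ccontr)
  fix u w assume "u \<in> S" "w \<in> S" "slope p v u = slope p v w" "u \<noteq> w"
  then show False using assms(2)[of u w] bracket_eq_slope[of p v u w] assms(1) by simp
qed

lemma generic_fst_neq: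
  assumes "generic_placement V p" "u \<in> V" "v \<in> V" "u \<noteq> v"
  shows "fst (p u) \<noteq> fst (p v)"
proof -
  have "(\<lambda>p. fst (p u) - fst (p v)) \<in> placement_polys V"
    using assms by (intro placement_polys_intros)
  from generic_placement_nonzero[OF assms(1) this, of "\<lambda>w. if w = u then (1, 0) else (0, 0)"]
  show ?thesis using assms(4) by simp
qed

lemma generic_bracket_neq:
  assumes "generic_placement V p" "u \<in> V" "v \<in> V" "w \<in> V" "u \<noteq> v" "u \<noteq> w" "v \<noteq> w"
  shows "bracket p u v w \<noteq> 0"
proof -
  have "(\<lambda>p. bracket p u v w) \<in> placement_polys V"
    unfolding bracket_def using assms by (intro placement_polys_intros)
  from generic_placement_nonzero[OF assms(1) this,
      of "\<lambda>x. if x = v then (1, 0) else if x = w then (0, 1) else (0, 0)"]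
  show ?thesis using assms(5-7) by (simp add: bracket_def)
qed

text \<open>The coefficient of the edge \<^term>\<open>{u, v}\<close>, oriented from \<^term>\<open>u\<close> to \<^term>\<open>v\<close>, in the
  linear dependence of the rows of the complete graph on \<^term>\<open>d + 2\<close> points \<^term>\<open>W\<close>.\<close>

definition stress :: "('v \<Rightarrow> real \<times> real) \<Rightarrow> 'v set \<Rightarrow> 'v \<Rightarrow> 'v \<Rightarrow> real" where
  "stress p W u v = 1 / (\<Prod>y\<in>W - {u, v}. bracket p u v y)"

text \<open>Each of the \<open>d\<close> brackets changes sign. Together with
  \<open>cofactor_vec_swap\<close> this makes the contributions of an edge at its two ends opposite,
  as in a row of the matrix.\<close>

lemma stress_swap:
  assumes "finite W" "card W = d + 2" "u \<in> W" "v \<in> W" "u \<noteq> v"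
  shows "stress p W v u = (-1) ^ d * stress p W u v"
proof -
  have "card (W - {u, v}) = d" using assms by (simp add: card_Diff_subset)
  moreover have "bracket p v u y = (-1) * bracket p u v y" for y
    by (simp add: bracket_def algebra_simps)
  ultimately have "(\<Prod>y\<in>W - {u, v}. bracket p v u y) = (-1) ^ d * (\<Prod>y\<in>W - {u, v}. bracket p u v y)"
    by (simp only: prod.distrib prod_constant)
  moreover have "1 / ((-1) ^ d * x) = (-1) ^ d * (1 / x)" for x :: real
    by (cases "even d") auto
  ultimately show ?thesis by (simp only: stress_def insert_commute)
qed

text \<open>Seen from \<open>w\<close>, the brackets factor into differences of x-coordinates and
  differences of slopes. After a factor common to all \<open>z\<close> is taken out, the sum is a
  divided difference of \<open>x ^ i\<close> at the \<open>d + 1\<close> slopes.\<close>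

lemma stress_equilibrium:
  assumes "generic_placement V p" "finite W" "W \<subseteq> V" "card W = d + 2" "w \<in> W" "i < d"
  shows "(\<Sum>z\<in>W - {w}. stress p W w z * cofactor_vec d p w z i) = 0"
proof -
  define S where "S = W - {w}"
  define D where "D z = fst (p w) - fst (p z)" for z
  define \<tau> where "\<tau> = slope p w"
  have S: "finite S" "card S = Suc d" using assms by (simp_all add: S_def)
  have x: "fst (p w) \<noteq> fst (p z)" if "z \<in> S" for z
    using that assms generic_fst_neq[OF assms(1), of w z] by (auto simp: S_def)
  then have D: "D z \<noteq> 0" if "z \<in> S" for z using that by (simp add: D_def)
  have "bracket p w u v \<noteq> 0" if "u \<in> S" "v \<in> S" "u \<noteq> v" for u v
    using that assms by (intro generic_bracket_neq[OF assms(1)]) (auto simp: S_def)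
  then have inj: "inj_on \<tau> S"
    unfolding \<tau>_def using x by (intro inj_on_slope) auto
  have "stress p W w z * cofactor_vec d p w z i
      = 1 / (\<Prod>y\<in>S. D y) * (\<tau> z ^ i / (\<Prod>y\<in>S - {z}. \<tau> y - \<tau> z))" if z: "z \<in> S" for z
  proof -
    have Wz: "W - {w, z} = S - {z}" by (auto simp: S_def)
    have "(\<Prod>y\<in>S - {z}. bracket p w z y) = (\<Prod>y\<in>S - {z}. D z * D y * (\<tau> y - \<tau> z))"
      unfolding D_def \<tau>_def using x z by (intro prod.cong refl bracket_eq_slope) auto
    then have "stress p W w z = 1 / (\<Prod>y\<in>S - {z}. D z * D y * (\<tau> y - \<tau> z))"
      by (simp only: stress_def Wz)
    also have "(\<Prod>y\<in>S - {z}. D z * D y * (\<tau> y - \<tau> z))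
        = D z ^ d * (\<Prod>y\<in>S - {z}. D y) * (\<Prod>y\<in>S - {z}. \<tau> y - \<tau> z)"
      using S z by (simp add: prod.distrib)
    \<comment> \<open>One of the \<open>d\<close> factors \<open>D z\<close> completes the product
      of \<open>D y\<close> over \<open>S\<close>, which does not depend on \<open>z\<close>; the
      other \<open>d - 1\<close> cancel against \<open>cofactor_vec_eq_slope\<close>.\<close>
    also have "D z ^ d = D z ^ (d - 1) * D z"
      using assms(6) by (cases d) auto
    finally have "stress p W w z = 1 / (D z ^ (d - 1) * (D z * (\<Prod>y\<in>S - {z}. D y)) * (\<Prod>y\<in>S - {z}. \<tau> y - \<tau> z))"
      by (simp only: mult.assoc)
    also have "D z * (\<Prod>y\<in>S - {z}. D y) = (\<Prod>y\<in>S. D y)"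
      using S z by (simp add: prod.remove)
    finally have st: "stress p W w z = 1 / (D z ^ (d - 1) * (\<Prod>y\<in>S. D y) * (\<Prod>y\<in>S - {z}. \<tau> y - \<tau> z))" .
    have "cofactor_vec d p w z i = D z ^ (d - 1) * \<tau> z ^ i"
      using cofactor_vec_eq_slope[OF assms(6), of p w z] x[OF z] by (simp add: D_def \<tau>_def)
    then show ?thesis unfolding st using D[OF z] by simp
  qed
  then have "(\<Sum>z\<in>S. stress p W w z * cofactor_vec d p w z i)
      = 1 / (\<Prod>y\<in>S. D y) * (\<Sum>z\<in>S. \<tau> z ^ i / (\<Prod>y\<in>S - {z}. \<tau> y - \<tau> z))"
    by (simp add: sum_distrib_left)
  then show ?thesis
    using divided_difference_power[OF S(1) inj S(2) assms(6)] by (simp add: S_def)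
qed

text \<open>One scalar \<open>t\<close> per edge works at both ends and absorbs the unknown
  orientation of the matrix row.\<close>

lemma edge_stress_exists:
  assumes "generic_placement V p" "finite W" "W \<subseteq> V" "card W = d + 2" "e \<in> complete_edges W"
  shows "\<exists>t. t \<noteq> 0 \<and> (\<forall>w z i. e = {w, z} \<longrightarrow> i < d \<longrightarrow>
    t * cofactor_matrix d p e (w, i) = stress p W w z * cofactor_vec d p w z i)"
proof -
  have sym: "stress p W b a * cofactor_vec d p b a i = - (stress p W a b * cofactor_vec d p a b i)"
    if "a \<in> W" "b \<in> W" "a \<noteq> b" "i < d" for a b i
  proof -
    have "(-1) ^ d * (-1) ^ d = (1::real)" by (simp flip: power_mult_distrib)
    then show ?thesis
      using stress_swap[OF assms(2,4) that(1-3), of p] cofactor_vec_swap[OF that(4), of p b a]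
      by (simp add: algebra_simps)
  qed
  have main: ?thesis if ab: "a \<in> W" "b \<in> W" "a \<noteq> b" "e = {a, b}"
    and row: "cofactor_matrix d p e = oriented_cofactor_row d p a b" for a b
  proof (intro exI[of _ "stress p W a b"] conjI allI impI)
    have "bracket p a b y \<noteq> 0" if "y \<in> W - {a, b}" for y
      using that ab assms(3) by (intro generic_bracket_neq[OF assms(1)]) auto
    then show "stress p W a b \<noteq> 0"
      using assms(2) by (simp add: stress_def)
    fix w z i assume "e = {w, z}" "i < d"
    then consider "w = a" "z = b" | "w = b" "z = a" using ab by (auto simp: doubleton_eq_iff)
    then show "stress p W a b * cofactor_matrix d p e (w, i) = stress p W w z * cofactor_vec d p w z i"
      using row sym[OF ab(1-3) \<open>i < d\<close>] ab(3) by cases (auto simp: oriented_cofactor_row_def)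
  qed
  obtain a b where ab: "a \<in> W" "b \<in> W" "a \<noteq> b" "e = {a, b}"
    using assms(5) by (auto simp: complete_edges_iff)
  from cofactor_matrix_orientation[OF ab(3), of d] show ?thesis
    using main[of a b] main[of b a] ab by (auto simp: insert_commute)
qed

text \<open>In the columns of a vertex \<open>w\<close> only the edges at \<open>w\<close>
  contribute, and there the relation is \<open>stress_equilibrium\<close>. All coefficients are
  nonzero, so any edge can be solved for.\<close>

lemma row_spanned_complete:
  assumes "generic_placement V p" "finite V" "W \<subseteq> V" "card W = d + 2" "e \<in> complete_edges W"
  shows "row_spanned (cofactor_matrix d p) (V \<times> {..<d}) (complete_edges W - {e}) e"
proof -
  have fin: "finite W" using assms finite_subset by blast
  then have finK: "finite (complete_edges W)" by (rule finite_complete_edges)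
  obtain t where t: "\<And>e. e \<in> complete_edges W \<Longrightarrow> t e \<noteq> 0"
    "\<And>e w z i. \<lbrakk>e \<in> complete_edges W; e = {w, z}; i < d\<rbrakk> \<Longrightarrow>
      t e * cofactor_matrix d p e (w, i) = stress p W w z * cofactor_vec d p w z i"
    using edge_stress_exists[OF assms(1) fin assms(3,4)] by metis
  show ?thesis
  proof (rule row_spanned_if_relation[where t = t])
    fix j assume "j \<in> V \<times> {..<d}"
    then obtain w i where j: "j = (w, i)" "i < d" by auto
    have "t e * cofactor_matrix d p e j + (\<Sum>f\<in>complete_edges W - {e}. t f * cofactor_matrix d p f j)
        = (\<Sum>f\<in>complete_edges W. t f * cofactor_matrix d p f j)"
      using sum.remove[OF finK assms(5), of "\<lambda>f. t f * cofactor_matrix d p f j"] by simp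
    also have "\<dots> = (\<Sum>f\<in>{f\<in>complete_edges W. w \<in> f}. t f * cofactor_matrix d p f j)"
      using finK j by (intro sum.mono_neutral_right) (auto dest: cofactor_matrix_outside)
    also have "\<dots> = 0"
    proof (cases "w \<in> W")
      case True
      have "(\<Sum>f\<in>{f\<in>complete_edges W. w \<in> f}. t f * cofactor_matrix d p f j)
          = (\<Sum>z\<in>W - {w}. t {w, z} * cofactor_matrix d p {w, z} j)"
      proof (rule sum.reindex_cong[of "\<lambda>z. {w, z}"])
        show "{f \<in> complete_edges W. w \<in> f} = (\<lambda>z. {w, z}) ` (W - {w})"
          using True by (auto simp: complete_edges_iff)
      qed (auto simp: inj_on_def doubleton_eq_iff)
      also have "\<dots> = (\<Sum>z\<in>W - {w}. stress p W w z * cofactor_vec d p w z i)"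
      proof (rule sum.cong[OF refl])
        fix z assume "z \<in> W - {w}"
        then have "{w, z} \<in> complete_edges W" using True by (auto simp: complete_edges_def)
        then show "t {w, z} * cofactor_matrix d p {w, z} j = stress p W w z * cofactor_vec d p w z i"
          unfolding j(1) by (rule t(2)[OF _ refl j(2)])
      qed
      finally show ?thesis using stress_equilibrium[OF assms(1) fin assms(3,4) True j(2)] by simp
    next
      case False
      then have "{f\<in>complete_edges W. w \<in> f} = {}" by (auto simp: complete_edges_def)
      then show ?thesis by (simp only: sum.empty)
    qed
    finally show "t e * cofactor_matrix d p e j
      + (\<Sum>f\<in>complete_edges W - {e}. t f * cofactor_matrix d p f j) = 0" .
  qed (use finK t(1) assms(5) in auto)
qed

definition cofactor_closed :: "nat \<Rightarrow> ('v \<Rightarrow> real \<times> real) \<Rightarrow> 'v set \<Rightarrow> 'v set set \<Rightarrow> bool" where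
  "cofactor_closed d p V E \<longleftrightarrow> E \<subseteq> complete_edges V \<and>
     (\<forall>e\<in>complete_edges V. row_spanned (cofactor_matrix d p) (V \<times> {..<d}) E e \<longrightarrow> e \<in> E)"

text \<open>A missing pair has \<open>x\<close> in \<open>A - B\<close> and \<open>y\<close> in
  \<open>B - A\<close>. With \<open>d\<close> common vertices they form a set of
  \<open>d + 2\<close> points in which every other pair lies inside \<open>A\<close> or inside
  \<open>B\<close>, so the stress puts \<open>{x, y}\<close> into the closure.\<close>

lemma cofactor_closed_glue:
  assumes "generic_placement V p" "finite V" "cofactor_closed d p V E" "A \<subseteq> V" "B \<subseteq> V"
    and "complete_edges A \<subseteq> E" "complete_edges B \<subseteq> E" "d \<le> card (A \<inter> B)"
  shows "complete_edges (A \<union> B) \<subseteq> E"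
proof -
  have finE: "finite E"
    using assms(2,3) finite_complete_edges finite_subset unfolding cofactor_closed_def by metis
  have cross: "{x, y} \<in> E" if xy: "x \<in> A - B" "y \<in> B - A" for x y
  proof -
    obtain Z where Z: "Z \<subseteq> A \<inter> B" "card Z = d" "finite Z"
      using obtain_subset_with_card_n[OF assms(8)] by blast
    define W where "W = insert x (insert y Z)"
    have "card W = d + 2"
      unfolding W_def using xy Z by (subst card_insert_disjoint; auto)+
    moreover have "W \<subseteq> V" using xy Z assms(4,5) by (auto simp: W_def)
    moreover have e: "{x, y} \<in> complete_edges W" using xy by (auto simp: W_def)
    ultimately have sp: "row_spanned (cofactor_matrix d p) (V \<times> {..<d}) (complete_edges W - {{x, y}}) {x, y}"
      using row_spanned_complete[OF assms(1,2)] by blast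
    have "complete_edges W - {{x, y}} \<subseteq> complete_edges A \<union> complete_edges B"
    proof
      fix e assume e: "e \<in> complete_edges W - {{x, y}}"
      then have "card e = 2" "finite e"
        by (auto simp: complete_edges_def intro: card_ge_0_finite)
      moreover have "x \<noteq> y" using xy by blast
      then have "card {x, y} = 2" by simp
      ultimately have "\<not> {x, y} \<subseteq> e"
        using e card_subset_eq[of e "{x, y}"] by auto
      then have "e \<subseteq> A \<or> e \<subseteq> B"
        using e xy Z by (auto simp: complete_edges_def W_def)
      then show "e \<in> complete_edges A \<union> complete_edges B"
        using \<open>card e = 2\<close> by (auto simp: complete_edges_def)
    qed
    then have "row_spanned (cofactor_matrix d p) (V \<times> {..<d}) E {x, y}"
      using row_spanned_mono[OF finE _ sp] assms(6,7) by blast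
    moreover have "{x, y} \<in> complete_edges V"
      using xy assms(4,5) by auto
    ultimately show ?thesis using assms(3) by (auto simp: cofactor_closed_def)
  qed
  show ?thesis
    unfolding complete_edges_subset_iff
  proof (intro ballI impI)
    fix x y assume xy: "x \<in> A \<union> B" "y \<in> A \<union> B" "x \<noteq> y"
    consider "x \<in> A" "y \<in> A" | "x \<in> B" "y \<in> B" | "x \<in> A - B" "y \<in> B - A" | "y \<in> A - B" "x \<in> B - A"
      using xy by blast
    then show "{x, y} \<in> E"
    proof cases
      case 1 then show ?thesis using assms(6) xy(3) unfolding complete_edges_subset_iff by blast
    next
      case 2 then show ?thesis using assms(7) xy(3) unfolding complete_edges_subset_iff by blast
    next
      case 3 then show ?thesis by (rule cross)
    next
      case 4 then show ?thesis using cross[of y x] by (simp add: insert_commute)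
    qed
  qed
qed

section \<open>Extensions\<close>

lemma sum_union_star:
  assumes "finite V" "I \<subseteq> complete_edges (V - {v})" "S \<subseteq> V - {v}"
  shows "(\<Sum>e\<in>I \<union> (\<lambda>u. {v, u}) ` S. f e) = (\<Sum>e\<in>I. f e) + (\<Sum>u\<in>S. f {v, u})"
proof -
  have fin: "finite I" "finite S"
    using assms finite_complete_edges[of "V - {v}"] by (auto intro: finite_subset)
  moreover have "I \<inter> (\<lambda>u. {v, u}) ` S = {}"
    using assms(2) by (auto simp: complete_edges_def)
  moreover have "inj_on (\<lambda>u. {v, u}) S"
    by (auto simp: inj_on_def doubleton_eq_iff)
  ultimately show ?thesis
    by (simp add: sum.union_disjoint sum.reindex)
qed

lemma card_union_star:
  assumes "finite V" "I \<subseteq> complete_edges (V - {v})" "S \<subseteq> V - {v}"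
  shows "card (I \<union> (\<lambda>u. {v, u}) ` S) = card I + card S"
  using sum_union_star[OF assms, of "\<lambda>_. 1 :: nat"] by simp

text \<open>The edges of \<open>I\<close> avoid \<open>v\<close>, so in the columns of
  \<open>v\<close> the relation involves the star alone. The coefficients \<open>s\<close> are those
  of \<open>t\<close> corrected by the orientation signs, with every star edge directed away from
  \<open>v\<close>.\<close>

lemma star_relation_at_center:
  fixes t :: "'v set \<Rightarrow> real"
  assumes "finite V" "v \<in> V" "I \<subseteq> complete_edges (V - {v})" "S \<subseteq> V - {v}"
    and t: "\<forall>j\<in>V \<times> {..<d}. (\<Sum>e\<in>I \<union> (\<lambda>u. {v, u}) ` S. t e * cofactor_matrix d p e j) = 0"
  obtains s where "\<forall>u\<in>S. s u = 0 \<longrightarrow> t {v, u} = 0"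
    "\<forall>i<d. (\<Sum>u\<in>S. s u * cofactor_vec d p v u i) = 0"
    "\<forall>w\<in>V. \<forall>i<d. (\<Sum>e\<in>I. t e * cofactor_matrix d p e (w, i))
       + (\<Sum>u\<in>S. s u * oriented_cofactor_row d p v u (w, i)) = 0"
proof -
  have "\<exists>\<sigma>::real. \<sigma> \<noteq> 0 \<and> (\<forall>w i. i < d \<longrightarrow>
      cofactor_matrix d p {v, u} (w, i) = \<sigma> * oriented_cofactor_row d p v u (w, i))" if "u \<in> S" for u
  proof -
    have "v \<noteq> u" using that assms(4) by blast
    from cofactor_matrix_oriented[OF this, of d p] show ?thesis by metis
  qed
  then obtain \<sigma> :: "'v \<Rightarrow> real" where \<sigma>: "\<And>u. u \<in> S \<Longrightarrow> \<sigma> u \<noteq> 0"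
    "\<And>u w i. u \<in> S \<Longrightarrow> i < d \<Longrightarrow>
      cofactor_matrix d p {v, u} (w, i) = \<sigma> u * oriented_cofactor_row d p v u (w, i)"
    by metis
  define s where "s u = t {v, u} * \<sigma> u" for u
  have all: "(\<Sum>e\<in>I. t e * cofactor_matrix d p e (w, i))
       + (\<Sum>u\<in>S. s u * oriented_cofactor_row d p v u (w, i)) = 0" if "w \<in> V" "i < d" for w i
  proof -
    have "(\<Sum>u\<in>S. s u * oriented_cofactor_row d p v u (w, i))
        = (\<Sum>u\<in>S. t {v, u} * cofactor_matrix d p {v, u} (w, i))"
      using \<sigma>(2) that(2) by (intro sum.cong) (auto simp: s_def)
    then show ?thesis
      using t that sum_union_star[OF assms(1,3,4), of "\<lambda>e. t e * cofactor_matrix d p e (w, i)"]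
      by simp
  qed
  have "(\<Sum>u\<in>S. s u * cofactor_vec d p v u i) = 0" if i: "i < d" for i
  proof -
    have "(\<Sum>e\<in>I. t e * cofactor_matrix d p e (v, i)) = 0"
    proof (rule sum.neutral, rule ballI)
      fix e assume "e \<in> I"
      then have e: "e \<in> complete_edges (V - {v})" using assms(3) by blast
      then have "v \<notin> e" by (auto simp: complete_edges_def)
      then show "t e * cofactor_matrix d p e (v, i) = 0"
        using cofactor_matrix_outside[OF e] by simp
    qed
    then show ?thesis using all[OF assms(2) i] by (simp add: oriented_cofactor_row_def)
  qed
  moreover have "t {v, u} = 0" if "u \<in> S" "s u = 0" for u
    using \<sigma>(1) that by (simp add: s_def)
  ultimately show ?thesis using that[of s] all by simp
qed

lemma cofactor_vecs_independent:
  assumes "finite S" "card S \<le> d" "\<And>u. u \<in> S \<Longrightarrow> fst (p v) \<noteq> fst (p u)" "inj_on (slope p v) S"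
    and "\<And>i. i < d \<Longrightarrow> (\<Sum>u\<in>S. s u * cofactor_vec d p v u i) = 0" and "u \<in> S"
  shows "s u = 0"
proof -
  have "(\<Sum>u\<in>S. (s u * (fst (p v) - fst (p u)) ^ (d - 1)) * slope p v u ^ i) = 0" if "i < d" for i
  proof -
    have "(\<Sum>u\<in>S. (s u * (fst (p v) - fst (p u)) ^ (d - 1)) * slope p v u ^ i)
        = (\<Sum>u\<in>S. s u * cofactor_vec d p v u i)"
      using cofactor_vec_eq_slope[OF that, of p v] assms(3) by (intro sum.cong) (auto simp: mult.assoc)
    then show ?thesis using assms(5)[OF that] by simp
  qed
  from vandermonde_independent[OF assms(1,4,2) this assms(6)]
  show ?thesis using assms(3)[OF assms(6)] by simp
qed

text \<open>At most \<open>d\<close> star vectors with distinct slopes are independent already in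
  the columns of \<open>v\<close>, so the star drops out of any relation.\<close>

lemma zero_extension:
  assumes "finite V" "v \<in> V" "I \<subseteq> complete_edges (V - {v})" "S \<subseteq> V - {v}" "card S \<le> d"
    and "\<And>u. u \<in> S \<Longrightarrow> fst (p v) \<noteq> fst (p u)" "inj_on (slope p v) S"
    and ind: "rows_independent (cofactor_matrix d p) (V \<times> {..<d}) I"
  shows "rows_independent (cofactor_matrix d p) (V \<times> {..<d}) (I \<union> (\<lambda>u. {v, u}) ` S)"
  unfolding rows_independent_def
proof (intro allI impI)
  fix t assume rel: "\<forall>j\<in>V \<times> {..<d}. (\<Sum>e\<in>I \<union> (\<lambda>u. {v, u}) ` S. t e * cofactor_matrix d p e j) = 0"
  obtain s where
    s: "\<forall>u\<in>S. s u = 0 \<longrightarrow> t {v, u} = 0"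
    "\<forall>i<d. (\<Sum>u\<in>S. s u * cofactor_vec d p v u i) = 0"
    "\<forall>w\<in>V. \<forall>i<d. (\<Sum>e\<in>I. t e * cofactor_matrix d p e (w, i))
       + (\<Sum>u\<in>S. s u * oriented_cofactor_row d p v u (w, i)) = 0"
    by (rule star_relation_at_center[OF assms(1-4) rel], rule that)
  have "finite S" using assms(1,4) finite_subset by blast
  then have s0: "s u = 0" if "u \<in> S" for u
    using cofactor_vecs_independent[of S d p v s u] assms(5-7) s(2) that by blast
  then have "\<forall>j\<in>V \<times> {..<d}. (\<Sum>e\<in>I. t e * cofactor_matrix d p e j) = 0"
    using s(3) by auto
  then have "\<forall>e\<in>I. t e = 0" using ind unfolding rows_independent_def by blast
  then show "\<forall>e\<in>I \<union> (\<lambda>u. {v, u}) ` S. t e = 0" using s0 s(1) by blast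
qed

text \<open>With \<^term>\<open>v\<close> on the line through \<^term>\<open>a\<close> and \<^term>\<open>b\<close>, the rows of \<^term>\<open>{v, a}\<close> and
  \<^term>\<open>{v, b}\<close> combine to the row of \<^term>\<open>{a, b}\<close>.\<close>

lemma one_extension_collinear:
  assumes "finite V" "v \<in> V" "I \<subseteq> complete_edges (V - {v})" "{a, b} \<notin> I"
    and T: "T \<subseteq> V - {v}" "a \<in> V - {v}" "b \<in> V - {v}" "a \<notin> T" "b \<notin> T" "a \<noteq> b" "card T < d"
    and pv: "p v = (2 * fst (p a) - fst (p b), 2 * snd (p a) - snd (p b))"
    and slopes: "\<And>u. u \<in> insert a T \<Longrightarrow> fst (p v) \<noteq> fst (p u)" "inj_on (slope p v) (insert a T)"
    and ind: "rows_independent (cofactor_matrix d p) (V \<times> {..<d}) (insert {a, b} I)"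
  shows "rows_independent (cofactor_matrix d p) (V \<times> {..<d})
    (I \<union> (\<lambda>u. {v, u}) ` (insert a (insert b T)))"
  unfolding rows_independent_def
proof (intro allI impI)
  let ?S = "insert a (insert b T)"
  fix t assume rel: "\<forall>j\<in>V \<times> {..<d}. (\<Sum>e\<in>I \<union> (\<lambda>u. {v, u}) ` ?S. t e * cofactor_matrix d p e j) = 0"
  have fin: "finite T" "finite I"
    using assms(1,3) T(1) finite_complete_edges[of "V - {v}"] by (auto intro: finite_subset)
  have S: "?S \<subseteq> V - {v}" using T by blast
  obtain s where
    s: "\<forall>u\<in>?S. s u = 0 \<longrightarrow> t {v, u} = 0"
    "\<forall>i<d. (\<Sum>u\<in>?S. s u * cofactor_vec d p v u i) = 0"
    "\<forall>w\<in>V. \<forall>i<d. (\<Sum>e\<in>I. t e * cofactor_matrix d p e (w, i))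
       + (\<Sum>u\<in>?S. s u * oriented_cofactor_row d p v u (w, i)) = 0"
    by (rule star_relation_at_center[OF assms(1-3) S rel], rule that)
  have sum_S: "(\<Sum>u\<in>?S. f u) = f a + f b + (\<Sum>u\<in>T. f u)" for f :: "'a \<Rightarrow> real"
    using fin T by (simp add: add.assoc)
  \<comment> \<open>Here \<open>p a\<close> is the midpoint of \<open>p v\<close> and
    \<open>p b\<close>: the direction from \<open>b\<close> to \<open>v\<close> is twice the one
    from \<open>b\<close> to \<open>a\<close>, and entries of degree \<open>d - 1\<close> scale by
    \<open>2 ^ (d - 1)\<close>.\<close>
  define k where "k = (2::real) ^ (d - 1)"
  have va: "cofactor_vec d p v a i = cofactor_vec d p a b i" for i
    by (simp add: cofactor_vec_def pv)
  have vb: "cofactor_vec d p v b i = k * cofactor_vec d p a b i" if "i < d" for i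
  proof -
    have diff: "fst (p v) - fst (p b) = 2 * (fst (p a) - fst (p b))"
      "snd (p v) - snd (p b) = 2 * (snd (p a) - snd (p b))" by (simp_all add: pv)
    have "k = 2 ^ (d - 1 - i) * 2 ^ i" using that by (simp add: k_def flip: power_add)
    then show ?thesis unfolding cofactor_vec_def diff power_mult_distrib by (simp only: mult_ac)
  qed
  \<comment> \<open>Merging the parallel vectors of \<open>a\<close> and \<open>b\<close> leaves the
    at most \<open>d\<close> slopes of \<open>insert a T\<close>, where independence is
    available.\<close>
  define s' where "s' = s(a := s a + k * s b)"
  have "(\<Sum>u\<in>insert a T. s' u * cofactor_vec d p v u i) = 0" if i: "i < d" for i
  proof -
    have "(\<Sum>u\<in>T. s' u * cofactor_vec d p v u i) = (\<Sum>u\<in>T. s u * cofactor_vec d p v u i)"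
      using T by (intro sum.cong) (auto simp: s'_def)
    then have "(\<Sum>u\<in>insert a T. s' u * cofactor_vec d p v u i)
        = (\<Sum>u\<in>?S. s u * cofactor_vec d p v u i)"
      unfolding sum_S using fin T vb[OF i] by (simp add: va s'_def algebra_simps)
    then show ?thesis using s(2) i by simp
  qed
  moreover have "card (insert a T) \<le> d" using fin T by simp
  ultimately have s'0: "s' u = 0" if "u \<in> insert a T" for u
    using cofactor_vecs_independent[of "insert a T" d p v s' u] fin slopes that by blast
  have sT: "s u = 0" if "u \<in> T" for u
    using s'0[of u] that T(4) by (auto simp: s'_def split: if_splits)
  have sa: "s a = - (k * s b)" using s'0[of a] by (simp add: s'_def)
  obtain \<sigma> where \<sigma>: "\<sigma> \<noteq> 0"
    "\<forall>w. \<forall>i<d. cofactor_matrix d p {a, b} (w, i) = \<sigma> * oriented_cofactor_row d p a b (w, i)"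
    by (rule cofactor_matrix_oriented[OF T(6)], rule that)
  \<comment> \<open>Once \<open>s a = - (k * s b)\<close>, the two star rows cancel in the columns
    of \<open>v\<close>, and what remains at \<open>a\<close> and \<open>b\<close> is
    \<open>- s a\<close> times the row directed from \<open>a\<close> to \<open>b\<close>.\<close>
  define t' where "t' = t({a, b} := - s a / \<sigma>)"
  have "(\<Sum>e\<in>insert {a, b} I. t' e * cofactor_matrix d p e j) = 0" if j: "j \<in> V \<times> {..<d}" for j
  proof -
    obtain w i where wi: "j = (w, i)" "w \<in> V" "i < d" using j by auto
    have "(\<Sum>e\<in>insert {a, b} I. t' e * cofactor_matrix d p e j)
        = t' {a, b} * cofactor_matrix d p {a, b} j + (\<Sum>e\<in>I. t' e * cofactor_matrix d p e j)"
      using fin assms(4) by simp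
    also have "(\<Sum>e\<in>I. t' e * cofactor_matrix d p e j) = (\<Sum>e\<in>I. t e * cofactor_matrix d p e j)"
      using assms(4) by (intro sum.cong) (auto simp: t'_def)
    also have "t' {a, b} * cofactor_matrix d p {a, b} j = - s a * oriented_cofactor_row d p a b (w, i)"
      using \<sigma> wi by (simp add: t'_def)
    also have "\<dots> = (\<Sum>u\<in>?S. s u * oriented_cofactor_row d p v u (w, i))"
    proof -
      have "(\<Sum>u\<in>T. s u * oriented_cofactor_row d p v u (w, i)) = 0"
        using sT by (intro sum.neutral) auto
      moreover have "s a * cofactor_vec d p a b i + s b * cofactor_vec d p v b i = 0"
        using vb[OF wi(3)] sa by simp
      ultimately show ?thesis
        unfolding sum_S using T va[of i] by (auto simp: oriented_cofactor_row_def)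
    qed
    finally show ?thesis using s(3) wi by (simp add: add.commute)
  qed
  then have t'0: "\<forall>e\<in>insert {a, b} I. t' e = 0"
    using ind unfolding rows_independent_def by blast
  then have "s a = 0" using \<sigma>(1) by (simp add: t'_def)
  moreover from this have "s b = 0" using sa by (simp add: k_def)
  ultimately have "\<forall>u\<in>?S. t {v, u} = 0" using sT s(1) by blast
  moreover have "\<forall>e\<in>I. t e = 0"
  proof
    fix e assume "e \<in> I"
    then have "e \<noteq> {a, b}" "t' e = 0" using assms(4) t'0 by auto
    then show "t e = 0" by (simp add: t'_def)
  qed
  ultimately show "\<forall>e\<in>I \<union> (\<lambda>u. {v, u}) ` ?S. t e = 0" by blast
qed

text \<open>Independence is checked at the degenerate placement \<open>move p\<close>, with
  \<open>v\<close> on the line through \<open>a\<close> and \<open>b\<close>, and carried back by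
  \<open>rows_independent_generic\<close>. The moved coordinates are rational polynomials in the old
  ones, so the remaining general position conditions again need only a witness.\<close>

lemma one_extension:
  assumes gen: "generic_placement V p" and "finite V" "v \<in> V" "I \<subseteq> complete_edges (V - {v})" "{a, b} \<notin> I"
    and T: "T \<subseteq> V - {v}" "a \<in> V - {v}" "b \<in> V - {v}" "a \<notin> T" "b \<notin> T" "a \<noteq> b" "card T < d"
    and ind: "rows_independent (cofactor_matrix d p) (V \<times> {..<d}) (insert {a, b} I)"
  shows "rows_independent (cofactor_matrix d p) (V \<times> {..<d})
    (I \<union> (\<lambda>u. {v, u}) ` (insert a (insert b T)))"
proof -
  define move :: "('a \<Rightarrow> real \<times> real) \<Rightarrow> 'a \<Rightarrow> real \<times> real" where
    "move p = p(v := (2 * fst (p a) - fst (p b), 2 * snd (p a) - snd (p b)))" for p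
  have move_fst: "(\<lambda>p. fst (move p u)) \<in> placement_polys V" if "u \<in> V" for u
    unfolding move_def using that T by (cases "u = v") (auto intro!: placement_polys_intros)
  have move_snd: "(\<lambda>p. snd (move p u)) \<in> placement_polys V" if "u \<in> V" for u
    unfolding move_def using that T by (cases "u = v") (auto intro!: placement_polys_intros)
  have x: "fst (move p v) \<noteq> fst (move p u)" if "u \<in> insert a T" for u
  proof -
    have u: "u \<in> V" "u \<noteq> v" "u \<noteq> b" using that T by auto
    have "(\<lambda>p. fst (move p v) - fst (move p u)) \<in> placement_polys V"
      using u assms(3) by (intro placement_polys_diff move_fst)
    from generic_placement_nonzero[OF gen this, of "\<lambda>w. if w = b then (1, 0) else (0, 0)"]
    show ?thesis using u T by (auto simp: move_def split: if_splits)
  qed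
  have br: "bracket (move p) v u w \<noteq> 0" if "u \<in> insert a T" "w \<in> insert a T" "u \<noteq> w" for u w
  proof -
    have u: "u \<in> V" "u \<noteq> v" "u \<noteq> b" "w \<in> V" "w \<noteq> v" "w \<noteq> b" using that T by auto
    have poly: "(\<lambda>p. bracket (move p) v u w) \<in> placement_polys V"
      unfolding bracket_def using u assms(3)
      by (intro placement_polys_diff placement_polys_mult move_fst move_snd)
    show ?thesis
    proof (cases "u = a \<or> w = a")
      case True
      \<comment> \<open>Here \<open>v\<close> moves to \<open>(-1, 0)\<close>, which is not
        collinear with \<open>a\<close> at the origin and the other point at
        \<open>(0, 1)\<close>.\<close>
      define q :: "'a \<Rightarrow> real \<times> real" where "q x = (if x = b then (1, 0) else if x = a then (0, 0) else (0, 1))" for x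
      have "bracket (move q) v u w \<noteq> 0"
        using True that(3) u T by (auto simp: bracket_def move_def q_def)
      then show ?thesis by (rule generic_placement_nonzero[OF gen poly])
    next
      case False
      \<comment> \<open>Both \<open>a\<close> and \<open>b\<close> lie at the origin, so
        \<open>v\<close> moves there too.\<close>
      define q :: "'a \<Rightarrow> real \<times> real" where "q x = (if x = u then (1, 0) else if x = w then (0, 1) else (0, 0))" for x
      have "bracket (move q) v u w \<noteq> 0"
        using False that(3) u T by (auto simp: bracket_def move_def q_def)
      then show ?thesis by (rule generic_placement_nonzero[OF gen poly])
    qed
  qed
  have "insert {a, b} I \<subseteq> complete_edges (V - {v})"
    using assms(4) T by auto
  then have "cofactor_matrix d (move p) e = cofactor_matrix d p e" if "e \<in> insert {a, b} I" for e
    using that by (intro cofactor_matrix_cong[of e "V - {v}"]) (auto simp: move_def complete_edges_def)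
  then have ind': "rows_independent (cofactor_matrix d (move p)) (V \<times> {..<d}) (insert {a, b} I)"
    using ind rows_independent_cong[of "insert {a, b} I" "V \<times> {..<d}" "cofactor_matrix d (move p)"] by simp
  have "rows_independent (cofactor_matrix d (move p)) (V \<times> {..<d})
      (I \<union> (\<lambda>u. {v, u}) ` (insert a (insert b T)))"
  proof (rule one_extension_collinear[OF assms(2-5) T])
    show "inj_on (slope (move p) v) (insert a T)"
      using x br by (intro inj_on_slope) auto
  qed (use x ind' T in \<open>auto simp: move_def\<close>)
  moreover have "I \<union> (\<lambda>u. {v, u}) ` (insert a (insert b T)) \<subseteq> complete_edges V"
    using assms(3,4) T complete_edges_mono[of "V - {v}" V] by auto
  ultimately show ?thesis
    using rows_independent_generic[OF gen assms(2)] by blast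
qed

section \<open>Highly connected graphs\<close>

lemma cofactor_indep_empty: "cofactor_indep d p V {}"
  by (simp add: cofactor_indep_def rows_independent_def)

lemma sum_cofactor_matrix_column:
  assumes "finite V" "e \<in> complete_edges V"
  shows "(\<Sum>w\<in>V. cofactor_matrix d p e (w, i)) = 0"
proof -
  have row: "(\<Sum>w\<in>V. oriented_cofactor_row d p u v (w, i)) = 0" if "u \<in> V" "v \<in> V" "u \<noteq> v" for u v
  proof -
    have "(\<Sum>w\<in>V. oriented_cofactor_row d p u v (w, i))
        = (\<Sum>w\<in>V. (if w = u then cofactor_vec d p u v i else 0) - (if w = v then cofactor_vec d p u v i else 0))"
      using that(3) by (intro sum.cong) (auto simp: oriented_cofactor_row_def)
    then show ?thesis using assms(1) that by (simp add: sum_subtractf)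
  qed
  obtain u v where e: "u \<in> V" "v \<in> V" "u \<noteq> v" "e = {u, v}"
    using assms(2) by (auto simp: complete_edges_iff)
  from cofactor_matrix_orientation[OF e(3), of d] show ?thesis
    using row e by auto
qed

text \<open>Translations lie in the kernel, so any single column is redundant.\<close>

lemma cofactor_rank_less:
  assumes "finite V" "V \<noteq> {}" "d \<ge> 1" "E \<subseteq> complete_edges V"
  shows "matroid_rank (cofactor_indep d p V) E < d * card V"
proof -
  have finE: "finite E" using assms finite_complete_edges finite_subset by blast
  obtain I where I: "I \<subseteq> E" "cofactor_indep d p V I" "card I = matroid_rank (cofactor_indep d p V) E"
    using matroid_rank_obtain[of E "cofactor_indep d p V"] finE cofactor_indep_empty by metis
  have finI: "finite I" using I finE finite_subset by blast
  obtain v where v: "v \<in> V" using assms(2) by blast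
  let ?C = "V \<times> {..<d}"
  have "rows_independent (cofactor_matrix d p) (?C - {(v, 0)}) I"
    unfolding rows_independent_def
  proof (intro allI impI)
    fix t assume t: "\<forall>j\<in>?C - {(v, 0)}. (\<Sum>e\<in>I. t e * cofactor_matrix d p e j) = 0"
    have "0 = (\<Sum>e\<in>I. t e * (\<Sum>w\<in>V. cofactor_matrix d p e (w, 0)))"
      using I assms(1,4) by (intro sum.neutral[symmetric]) (auto simp: sum_cofactor_matrix_column)
    also have "\<dots> = (\<Sum>w\<in>V. \<Sum>e\<in>I. t e * cofactor_matrix d p e (w, 0))"
      by (subst sum.swap) (simp add: sum_distrib_left)
    also have "\<dots> = (\<Sum>w\<in>{v}. \<Sum>e\<in>I. t e * cofactor_matrix d p e (w, 0))"
      using t v assms(1,3) by (intro sum.mono_neutral_right) auto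
    finally have "\<forall>j\<in>?C. (\<Sum>e\<in>I. t e * cofactor_matrix d p e j) = 0"
      using t by auto
    then show "\<forall>e\<in>I. t e = 0"
      using I(2) unfolding cofactor_indep_def rows_independent_def by blast
  qed
  then have "card I \<le> card (?C - {(v, 0)})"
    using finI assms(1) by (intro rows_independent_card_le) auto
  also have "\<dots> < card ?C"
    using v assms(1,3) by (intro card_Diff1_less) auto
  finally show ?thesis using I(3) by (simp add: card_cartesian_product mult.commute)
qed

text \<open>A maximum independent set \<open>I\<close> inside \<open>U\<close> is extended by edges
  at \<open>v\<close>. Closedness is what makes a 1-extension possible: a missing pair
  \<open>{a, b}\<close> is not spanned by \<open>E\<close>, so it can be added to \<open>I\<close>
  and then traded for \<open>d + 1\<close> edges at \<open>v\<close>, all of which belong to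
  \<open>E\<close>.\<close>

lemma rank_increment:
  assumes gen: "generic_placement V p" and "finite V" and closed: "cofactor_closed d p V E" and "d \<ge> 1"
    and "v \<in> V" "U \<subseteq> V - {v}" and S: "S = {u \<in> U. {v, u} \<in> E}"
  shows "real (min d (card S)) + (if d < card S \<and> \<not> complete_edges S \<subseteq> E then 1 else 0)
    \<le> real (matroid_rank (cofactor_indep d p V) {e \<in> E. e \<subseteq> insert v U})
       - real (matroid_rank (cofactor_indep d p V) {e \<in> E. e \<subseteq> U})"
proof -
  have EV: "E \<subseteq> complete_edges V" using closed by (simp add: cofactor_closed_def)
  have finE: "finite E" using EV assms(2) finite_complete_edges finite_subset by blast
  obtain I where I: "I \<subseteq> {e \<in> E. e \<subseteq> U}" "cofactor_indep d p V I"
    "card I = matroid_rank (cofactor_indep d p V) {e \<in> E. e \<subseteq> U}"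
  proof (rule matroid_rank_obtain[where indep = "cofactor_indep d p V"])
    show "finite {e \<in> E. e \<subseteq> U}" using finE by simp
  qed (rule cofactor_indep_empty)
  have IV: "I \<subseteq> complete_edges (V - {v})"
  proof
    fix e assume "e \<in> I"
    then have "e \<subseteq> U" "e \<in> complete_edges V" using I(1) EV by auto
    then show "e \<in> complete_edges (V - {v})" using assms(6) unfolding complete_edges_def by blast
  qed
  have ind: "rows_independent (cofactor_matrix d p) (V \<times> {..<d}) I"
    using I(2) by (simp add: cofactor_indep_def)
  have SV: "S \<subseteq> V - {v}" using S assms(6) by blast
  have finS: "finite S" using SV assms(2) finite_subset by blast
  have lower: "card I + card T \<le> matroid_rank (cofactor_indep d p V) {e \<in> E. e \<subseteq> insert v U}"
    if "T \<subseteq> S" "rows_independent (cofactor_matrix d p) (V \<times> {..<d}) (I \<union> (\<lambda>u. {v, u}) ` T)" for T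
  proof -
    have "card (I \<union> (\<lambda>u. {v, u}) ` T) = card I + card T"
      using that SV by (intro card_union_star[OF assms(2) IV]) auto
    moreover have sub: "I \<union> (\<lambda>u. {v, u}) ` T \<subseteq> {e \<in> E. e \<subseteq> insert v U}"
      using I(1) that S by auto
    moreover have "cofactor_indep d p V (I \<union> (\<lambda>u. {v, u}) ` T)"
      using that(2) sub EV by (auto simp: cofactor_indep_def)
    moreover have "finite {e \<in> E. e \<subseteq> insert v U}" using finE by simp
    ultimately show ?thesis
      using card_le_matroid_rank[of "{e \<in> E. e \<subseteq> insert v U}" "I \<union> (\<lambda>u. {v, u}) ` T"] by metis
  qed
  show ?thesis
  proof (cases "d < card S \<and> \<not> complete_edges S \<subseteq> E")
    case True
    then obtain a b where ab: "a \<in> S" "b \<in> S" "a \<noteq> b" "{a, b} \<notin> E"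
      by (auto simp: complete_edges_subset_iff)
    have "d - 1 \<le> card (S - {a, b})"
      using True ab finS by (auto simp: card_Diff_subset)
    then obtain T where T: "T \<subseteq> S - {a, b}" "card T = d - 1" "finite T"
      using obtain_subset_with_card_n by metis
    have "{a, b} \<in> complete_edges V" using ab SV by auto
    then have "\<not> row_spanned (cofactor_matrix d p) (V \<times> {..<d}) E {a, b}"
      using closed ab(4) by (auto simp: cofactor_closed_def)
    then have "rows_independent (cofactor_matrix d p) (V \<times> {..<d}) (insert {a, b} I)"
      using rows_independent_insert[OF finE _ ind] I(1) by blast
    then have "rows_independent (cofactor_matrix d p) (V \<times> {..<d})
        (I \<union> (\<lambda>u. {v, u}) ` insert a (insert b T))"
      using T ab SV I(1) assms(4,5)
      by (intro one_extension[OF gen assms(2,5) IV]) auto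
    then have "card I + card (insert a (insert b T))
        \<le> matroid_rank (cofactor_indep d p V) {e \<in> E. e \<subseteq> insert v U}"
      using T ab by (intro lower) auto
    moreover have "card (insert a (insert b T)) = d + 1"
    proof -
      have "a \<notin> insert b T" "b \<notin> T" using T ab by auto
      then show ?thesis using T assms(4) by simp
    qed
    ultimately show ?thesis using True I(3) by simp
  next
    case False
    obtain T where T: "T \<subseteq> S" "card T = min d (card S)" "finite T"
      using obtain_subset_with_card_n[of "min d (card S)" S] by auto
    have x: "fst (p v) \<noteq> fst (p u)" if "u \<in> T" for u
      using that T SV assms(5) by (intro generic_fst_neq[OF gen]) auto
    have "bracket p v u w \<noteq> 0" if "u \<in> T" "w \<in> T" "u \<noteq> w" for u w
      using that T SV assms(5) by (intro generic_bracket_neq[OF gen]) auto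
    then have "inj_on (slope p v) T" using x by (intro inj_on_slope) auto
    then have "rows_independent (cofactor_matrix d p) (V \<times> {..<d}) (I \<union> (\<lambda>u. {v, u}) ` T)"
      using T SV x by (intro zero_extension[OF assms(2,5) IV] ind) auto
    from lower[OF T(1) this] show ?thesis unfolding if_not_P[OF False] using T(2) I(3) by simp
  qed
qed

section \<open>Degrees, connectivity and deletion of a vertex\<close>

definition neighbours :: "'v set \<Rightarrow> 'v set set \<Rightarrow> 'v \<Rightarrow> 'v set" where
  "neighbours V E v = {u \<in> V. {v, u} \<in> E}"

lemma rtrancl_first_step:
  assumes "(u, w) \<in> R\<^sup>*" "u \<noteq> w"
  obtains x where "(u, x) \<in> R"
  using assms by (metis converse_rtranclE)

text \<open>Deleting the neighbourhood isolates \<open>v\<close> from the rest.\<close>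

lemma k_connected_degree:
  assumes "finite V" "E \<subseteq> complete_edges V" "k_connected k V E" "v \<in> V"
  shows "k \<le> card (neighbours V E v)"
proof (rule ccontr)
  let ?N = "neighbours V E v"
  assume small: "\<not> k \<le> card ?N"
  have N: "?N \<subseteq> V" "v \<notin> ?N" using assms(2) by (auto simp: neighbours_def complete_edges_def)
  have conn: "connected_graph (V - ?N) (delete_vertices ?N E)"
    using assms(3) small N by (auto simp: k_connected_def)
  have "card (insert v ?N) \<le> Suc (card ?N)" by (rule card_insert_le_m1) simp_all
  then have "card (insert v ?N) < card V"
    using small assms(3) by (auto simp: k_connected_def)
  then have "insert v ?N \<noteq> V" by auto
  then obtain w where w: "w \<in> V - ?N" "v \<noteq> w" using N assms(4) by blast
  have "(v, w) \<in> {(a, b). {a, b} \<in> delete_vertices ?N E}\<^sup>*"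
    using conn w N assms(4) by (auto simp: connected_graph_def)
  then obtain x where "{v, x} \<in> delete_vertices ?N E"
    using rtrancl_first_step[OF _ w(2)] by auto
  then have "{v, x} \<in> E" "x \<notin> ?N" by (auto simp: delete_vertices_def)
  moreover from this(1) have "x \<in> V" using assms(2) by (auto simp: complete_edges_def)
  ultimately show False by (simp add: neighbours_def)
qed

text \<open>A walk through \<open>v\<close> enters and leaves it by neighbours, which coincide or
  are adjacent, so the visit to \<open>v\<close> can be cut out.\<close>

lemma k_connected_delete_simplicial:
  assumes "finite V" "E \<subseteq> complete_edges V" "k_connected k V E" "v \<in> V" "k + 2 \<le> card V"
    and simplicial: "complete_edges (neighbours V E v) \<subseteq> E"
  shows "k_connected k (V - {v}) (delete_vertices {v} E)"
  unfolding k_connected_def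
proof (intro conjI allI impI)
  show "k + 1 \<le> card (V - {v})" using assms(1,4,5) by simp
  fix S assume S: "S \<subseteq> V - {v} \<and> card S < k"
  define R where "R = {(a, b). {a, b} \<in> delete_vertices S E}"
  define R' where "R' = {(a, b). {a, b} \<in> delete_vertices S (delete_vertices {v} E)}"
  have conn: "connected_graph (V - S) (delete_vertices S E)"
    using assms(3) S by (auto simp: k_connected_def)
  \<comment> \<open>The claim for walks ending at \<open>v\<close> says that any next vertex is
    already reachable without \<open>v\<close>; this keeps the induction going while the walk sits
    at \<open>v\<close>.\<close>
  have path: "(x \<noteq> v \<longrightarrow> (u, x) \<in> R'\<^sup>*) \<and> (x = v \<longrightarrow> (\<forall>y. (v, y) \<in> R \<longrightarrow> (u, y) \<in> R'\<^sup>*))"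
    if "(u, x) \<in> R\<^sup>*" "u \<noteq> v" for u x
    using that
  proof (induction rule: rtrancl_induct)
    case (step x y)
    have "{x, y} \<in> E" "x \<notin> S" "y \<notin> S" using step(2) by (auto simp: R_def delete_vertices_def)
    moreover from this(1) have "{x, y} \<in> complete_edges V" using assms(2) by (rule subsetD[rotated])
    ultimately have xy: "{x, y} \<in> E" "x \<notin> S" "y \<notin> S" "x \<in> V" "y \<in> V" "x \<noteq> y" by simp_all
    show ?case
    proof (cases "y = v")
      case True
      have ux: "(u, x) \<in> R'\<^sup>*" using step xy True by auto
      have "(u, z) \<in> R'\<^sup>*" if "(v, z) \<in> R" for z
      proof (cases "x = z")
        case False
        have "{v, z} \<in> E" "z \<notin> S" using that by (auto simp: R_def delete_vertices_def)
        moreover from this(1) have "{v, z} \<in> complete_edges V" using assms(2) by (rule subsetD[rotated])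
        ultimately have z: "{v, z} \<in> E" "z \<notin> S" "z \<in> V" "z \<noteq> v" by auto
        have "x \<in> neighbours V E v" "z \<in> neighbours V E v"
          using xy True z by (auto simp: neighbours_def insert_commute)
        then have "{x, z} \<in> E" using simplicial False unfolding complete_edges_subset_iff by blast
        then have "(x, z) \<in> R'" using xy True z by (auto simp: R'_def delete_vertices_def)
        with ux show ?thesis by (rule rtrancl_into_rtrancl)
      qed (use ux in simp)
      then show ?thesis using True by blast
    next
      case False
      show ?thesis
      proof (cases "x = v")
        case True
        then show ?thesis using step False by auto
      next
        case xv: False
        then have "(x, y) \<in> R'" using xy False by (auto simp: R'_def delete_vertices_def)
        then show ?thesis using step xv False by (auto intro: rtrancl_into_rtrancl)
      qed
    qed
  qed auto
  have "card S < card (V - {v})" using S assms(5) by (auto simp: card_Diff_singleton[OF assms(4)])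
  then have "V - {v} - S \<noteq> {}"
    using S assms(1) by (metis Diff_eq_empty_iff card_mono finite_Diff finite_subset linorder_not_le)
  moreover have "(u, w) \<in> R'\<^sup>*" if "u \<in> V - {v} - S" "w \<in> V - {v} - S" for u w
  proof -
    have "(u, w) \<in> R\<^sup>*" using conn that by (auto simp: connected_graph_def R_def)
    then show ?thesis using path[of u w] that by auto
  qed
  ultimately show "connected_graph (V - {v} - S) (delete_vertices S (delete_vertices {v} E))"
    by (auto simp: connected_graph_def R'_def)
qed

lemma generic_placement_subset:
  assumes "generic_placement V p" "U \<subseteq> V"
  shows "generic_placement U p"
proof -
  have "U <+> U \<subseteq> V <+> V" using assms(2) by auto
  then show ?thesis
    using assms(1) unfolding generic_placement_def alg_independent_over_rat_def
    by (meson order_trans)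
qed

text \<open>Edges avoiding \<open>v\<close> have zero entries in the columns of \<open>v\<close>, so
  spanning over the columns of \<open>V - {v}\<close> is spanning over all columns.\<close>

lemma cofactor_closed_delete:
  assumes "finite V" "cofactor_closed d p V E"
  shows "cofactor_closed d p (V - {v}) (delete_vertices {v} E)"
  unfolding cofactor_closed_def
proof (intro conjI ballI impI)
  let ?E = "delete_vertices {v} E"
  have EV: "E \<subseteq> complete_edges V" using assms(2) by (simp add: cofactor_closed_def)
  then show EV': "?E \<subseteq> complete_edges (V - {v})"
    by (auto simp: delete_vertices_def complete_edges_def)
  fix e assume e: "e \<in> complete_edges (V - {v})"
    and "row_spanned (cofactor_matrix d p) ((V - {v}) \<times> {..<d}) ?E e"
  then obtain c where c: "\<And>j. j \<in> (V - {v}) \<times> {..<d} \<Longrightarrow>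
      cofactor_matrix d p e j = (\<Sum>f\<in>?E. c f * cofactor_matrix d p f j)"
    unfolding row_spanned_def by blast
  have out: "cofactor_matrix d p f (v, i) = 0" if "f \<in> complete_edges (V - {v})" for f i
    using that by (intro cofactor_matrix_outside[OF that]) (auto simp: complete_edges_def)
  have "cofactor_matrix d p e j = (\<Sum>f\<in>?E. c f * cofactor_matrix d p f j)" if "j \<in> V \<times> {..<d}" for j
  proof (cases "fst j = v")
    case True
    then obtain i where j: "j = (v, i)" by (cases j) auto
    have "(\<Sum>f\<in>?E. c f * cofactor_matrix d p f j) = 0"
      unfolding j using out EV' by (intro sum.neutral) auto
    then show ?thesis using out[OF e] j by simp
  qed (use that c in auto)
  then have "row_spanned (cofactor_matrix d p) (V \<times> {..<d}) ?E e"
    unfolding row_spanned_def by (intro exI[of _ c] ballI)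
  moreover have "finite E" using EV assms(1) finite_complete_edges finite_subset by blast
  ultimately have "row_spanned (cofactor_matrix d p) (V \<times> {..<d}) E e"
    using row_spanned_mono[of E ?E] by (auto simp: delete_vertices_def)
  moreover have "e \<in> complete_edges V" "v \<notin> e" using e by (auto simp: complete_edges_def)
  ultimately show "e \<in> ?E" using assms(2) by (auto simp: cofactor_closed_def delete_vertices_def)
qed

section \<open>Rank count and induction on the number of vertices\<close>

lemma exists_simplicial_vertex:
  assumes gen: "generic_placement V p" and "finite V" "V \<noteq> {}" "d \<ge> 1"
    and closed: "cofactor_closed d p V E"
    and deg: "\<And>v. v \<in> V \<Longrightarrow> d * (d + 1) \<le> card (neighbours V E v)"
  shows "\<exists>v\<in>V. complete_edges (neighbours V E v) \<subseteq> E"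
proof (rule ccontr)
  assume nonsimplicial: "\<not> ?thesis"
  let ?N = "neighbours V E"
  define f where "f U = real (matroid_rank (cofactor_indep d p V) {e \<in> E. e \<subseteq> U})" for U
  define g where "g S = real (min d (card S)) + (if d < card S \<and> \<not> complete_edges S \<subseteq> E then 1 else 0)" for S
  have EV: "E \<subseteq> complete_edges V" using closed by (simp add: cofactor_closed_def)
  have N: "?N v \<subseteq> V - {v}" for v using EV by (auto simp: neighbours_def complete_edges_def)
  have "real d \<le> (\<Sum>U\<in>Pow (V - {v}). predecessor_weight (card V - 1) (card U) * (f (insert v U) - f U))"
    if v: "v \<in> V" for v
  proof -
    define K where "K = {A. A \<subseteq> ?N v \<and> complete_edges A \<subseteq> E}"
    have finN: "finite (?N v)" using N[of v] assms(2) finite_subset by blast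
    have "real d \<le> (\<Sum>S\<in>Pow (?N v). predecessor_weight (card (?N v)) (card S) *
           (real (min d (card S)) + (if d < card S \<and> S \<notin> K then 1 else 0)))"
    proof (rule average_increment_ge[OF finN \<open>d \<ge> 1\<close> deg[OF v]])
      show "?N v \<notin> K" using nonsimplicial v by (auto simp: K_def)
      show "A \<union> B \<in> K" if AB: "A \<in> K" "B \<in> K" "d - 1 \<le> card (A \<inter> B)" for A B
      proof -
        have sub: "A \<subseteq> ?N v" "B \<subseteq> ?N v" using AB by (auto simp: K_def)
        have star: "complete_edges (insert v C) \<subseteq> E" if "C \<in> K" for C
          using that unfolding K_def complete_edges_subset_iff
          by (auto simp: neighbours_def insert_commute)
        have "finite (A \<inter> B)" "v \<notin> A \<inter> B"
          using sub N[of v] finite_subset[OF sub(1) finN] by auto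
        \<comment> \<open>Joining \<open>v\<close> to both cliques adds one common vertex. Hence
          cliques inside the neighbourhood glue already along \<open>d - 1\<close> vertices.\<close>
        then have "d \<le> card (insert v A \<inter> insert v B)"
          using AB(3) by (simp add: insert_inter_insert)
        then have "complete_edges (insert v A \<union> insert v B) \<subseteq> E"
          using sub N[of v] v star AB(1,2)
          by (intro cofactor_closed_glue[OF gen assms(2) closed]) auto
        then have "complete_edges (A \<union> B) \<subseteq> E"
          using complete_edges_mono[of "A \<union> B" "insert v A \<union> insert v B"] by blast
        then show ?thesis using sub by (simp add: K_def)
      qed
    qed (simp add: K_def)
    also have "\<dots> = (\<Sum>S\<in>Pow (?N v). predecessor_weight (card (?N v)) (card S) * g S)"
      by (intro sum.cong) (auto simp: g_def K_def)
    also have "\<dots> = (\<Sum>U\<in>Pow (V - {v}). predecessor_weight (card (V - {v})) (card U) * g (U \<inter> ?N v))"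
      using assms(2) N by (intro sum_predecessor_weight_marginal[symmetric]) auto
    also have "\<dots> \<le> (\<Sum>U\<in>Pow (V - {v}). predecessor_weight (card (V - {v})) (card U) * (f (insert v U) - f U))"
    proof (intro sum_mono mult_left_mono predecessor_weight_nonneg)
      fix U assume "U \<in> Pow (V - {v})"
      then show "g (U \<inter> ?N v) \<le> f (insert v U) - f U"
        unfolding g_def f_def using v
        by (intro rank_increment[OF gen assms(2) closed \<open>d \<ge> 1\<close>]) (auto simp: neighbours_def)
    qed
    finally show ?thesis using v assms(2) by simp
  qed
  then have "(\<Sum>v\<in>V. real d) \<le> f V - f {}"
    unfolding sum_shapley[OF assms(2,3), symmetric] by (intro sum_mono)
  moreover have "0 \<le> f {}" by (simp add: f_def)
  moreover have "{e \<in> E. e \<subseteq> V} = E" using EV by (auto simp: complete_edges_def)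
  then have "f V < real (d * card V)"
    using cofactor_rank_less[OF assms(2,3) \<open>d \<ge> 1\<close> EV, of p] unfolding f_def of_nat_less_iff by simp
  ultimately show False by (simp add: mult.commute)
qed

text \<open>With exactly \<open>d * (d + 1) + 1\<close> vertices the degree bound makes every vertex
  adjacent to all others. With more, a vertex \<open>v\<close> with a clique as neighbourhood is
  deleted; the complete rest and the closed neighbourhood of \<open>v\<close> share the at least
  \<open>d\<close> neighbours of \<open>v\<close> and are glued along them. The placement stays the
  same throughout.\<close>

lemma closed_k_connected_complete:
  assumes "generic_placement V p" "finite V" "d \<ge> 1" "cofactor_closed d p V E"
    and "k_connected (d * (d + 1)) V E"
  shows "complete_edges V \<subseteq> E"
  using assms
proof (induction "card V" arbitrary: V E rule: less_induct)
  case less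
  note gen = less.prems(1) and fin = less.prems(2) and closed = less.prems(4) and conn = less.prems(5)
  let ?k = "d * (d + 1)"
  have EV: "E \<subseteq> complete_edges V" using closed by (simp add: cofactor_closed_def)
  have deg: "?k \<le> card (neighbours V E v)" if "v \<in> V" for v
    using k_connected_degree[OF fin EV conn that] .
  have kV: "?k + 1 \<le> card V" using conn by (simp add: k_connected_def)
  then have "V \<noteq> {}" by auto
  from exists_simplicial_vertex[OF gen fin this \<open>d \<ge> 1\<close> closed deg] obtain v
    where v: "v \<in> V" "complete_edges (neighbours V E v) \<subseteq> E" by blast
  have N: "neighbours V E u \<subseteq> V - {u}" for u
    using EV by (auto simp: neighbours_def complete_edges_def)
  show ?case
  proof (cases "card V = ?k + 1")
    case True
    have "neighbours V E u = V - {u}" if "u \<in> V" for u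
      using deg[OF that] True that fin by (intro card_seteq N) auto
    then show ?thesis unfolding complete_edges_subset_iff neighbours_def by blast
  next
    case False
    then have "?k + 2 \<le> card V" using kV by simp
    have "complete_edges (V - {v}) \<subseteq> delete_vertices {v} E"
    proof (rule less.hyps)
      show "card (V - {v}) < card V" using v fin by (intro psubset_card_mono) auto
      show "k_connected ?k (V - {v}) (delete_vertices {v} E)"
        using k_connected_delete_simplicial[OF fin EV conn v(1) \<open>?k + 2 \<le> card V\<close> v(2)] .
      show "generic_placement (V - {v}) p" by (rule generic_placement_subset[OF gen]) blast
    qed (use fin \<open>d \<ge> 1\<close> cofactor_closed_delete[OF fin closed] in auto)
    then have "complete_edges (V - {v}) \<subseteq> E" by (auto simp: delete_vertices_def)
    moreover have "complete_edges (insert v (neighbours V E v)) \<subseteq> E"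
      using v(2) unfolding complete_edges_subset_iff by (auto simp: neighbours_def insert_commute)
    moreover have "(V - {v}) \<inter> insert v (neighbours V E v) = neighbours V E v"
      using N[of v] by blast
    moreover have "d \<le> ?k" by simp
    then have "d \<le> card (neighbours V E v)" using deg[OF v(1)] by (rule order_trans)
    ultimately have "complete_edges ((V - {v}) \<union> insert v (neighbours V E v)) \<subseteq> E"
      using N[of v] v(1) by (intro cofactor_closed_glue[OF gen fin closed]) auto
    moreover have "(V - {v}) \<union> insert v (neighbours V E v) = V" using N[of v] v(1) by blast
    ultimately show ?thesis by simp
  qed
qed

text \<open>A maximum independent subset \<open>I\<close> of \<open>E\<close> spans
  \<open>E\<close>, hence also \<open>e\<close>, so no independent subset of
  \<open>insert e E\<close> can be larger than \<open>I\<close>.\<close>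

lemma matroid_rank_insert_spanned:
  assumes "finite V" "E \<subseteq> complete_edges V" "e \<in> complete_edges V"
    and "row_spanned (cofactor_matrix d p) (V \<times> {..<d}) E e"
  shows "matroid_rank (cofactor_indep d p V) (insert e E) = matroid_rank (cofactor_indep d p V) E"
proof -
  have finE: "finite E" using assms finite_complete_edges finite_subset by blast
  obtain I where I: "I \<subseteq> E" "cofactor_indep d p V I" "card I = matroid_rank (cofactor_indep d p V) E"
    using matroid_rank_obtain[of E "cofactor_indep d p V"] finE cofactor_indep_empty by metis
  obtain J where J: "J \<subseteq> insert e E" "cofactor_indep d p V J"
    "card J = matroid_rank (cofactor_indep d p V) (insert e E)"
    using matroid_rank_obtain[of "insert e E" "cofactor_indep d p V"] finE cofactor_indep_empty
    by (metis finite_insert)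
  have fin: "finite I" "finite J" using I(1) J(1) finE by (auto intro: finite_subset)
  let ?sp = "row_spanned (cofactor_matrix d p) (V \<times> {..<d})"
  have spE: "?sp I f" if f: "f \<in> E" for f
  proof (rule ccontr)
    assume not: "\<not> ?sp I f"
    then have "f \<notin> I" using row_spanned_in[OF fin(1)] by metis
    have "rows_independent (cofactor_matrix d p) (V \<times> {..<d}) (insert f I)"
      using I(2) by (intro rows_independent_insert[OF fin(1) order_refl _ not]) (simp add: cofactor_indep_def)
    then have "cofactor_indep d p V (insert f I)"
      using I(1) f assms(2) by (auto simp: cofactor_indep_def)
    then have "card (insert f I) \<le> card I"
      using card_le_matroid_rank[OF finE, of "insert f I" "cofactor_indep d p V"] f I(1,3) by simp
    then show False using \<open>f \<notin> I\<close> fin by simp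
  qed
  then have "?sp I e" by (rule row_spanned_trans[OF assms(4)])
  then have "card J \<le> card I"
    using J spE by (intro card_le_of_row_spanned[OF fin]) (auto simp: cofactor_indep_def)
  moreover have "card I \<le> card J"
    using card_le_matroid_rank[of "insert e E" I "cofactor_indep d p V"] finE I(1,2) J(3) by auto
  ultimately show ?thesis using I(3) J(3) by simp
qed

theorem theorem6p3:
  fixes d :: nat and V :: "'v set" and E :: "'v set set"
  assumes "d \<ge> 2"
    and "simple_graph V E"
    and "k_connected (d * (d + 1)) V E"
  shows "generically_cofactor_rigid d V E"
  unfolding generically_cofactor_rigid_def
proof (intro allI impI)
  fix p :: "'v \<Rightarrow> real \<times> real"
  assume gen: "generic_placement V p"
  have fin: "finite V" and EV: "E \<subseteq> complete_edges V"
    using assms(2) by (auto simp: simple_graph_def)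
  have finE: "finite E" using EV fin finite_complete_edges finite_subset by blast
  let ?sp = "row_spanned (cofactor_matrix d p) (V \<times> {..<d})"
  \<comment> \<open>The closure of \<open>E\<close>, described by spans. It contains
    \<open>E\<close> and inherits its connectivity, and once it is complete every edge is spanned by
    \<open>E\<close>, so inserting one leaves the rank unchanged.\<close>
  define F where "F = {e \<in> complete_edges V. ?sp E e}"
  have EF: "E \<subseteq> F" using EV row_spanned_in[OF finE] unfolding F_def by blast
  have "cofactor_closed d p V F"
    unfolding cofactor_closed_def
  proof (intro conjI ballI impI)
    fix e assume "e \<in> complete_edges V" "?sp F e"
    moreover have "?sp E f" if "f \<in> F" for f using that by (simp add: F_def)
    ultimately show "e \<in> F" using row_spanned_trans[of _ _ F e E] unfolding F_def by blast
  qed (auto simp: F_def)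
  moreover have "k_connected (d * (d + 1)) V F"
    unfolding k_connected_def
  proof (intro conjI allI impI)
    show "d * (d + 1) + 1 \<le> card V" using assms(3) by (simp add: k_connected_def)
    fix S assume "S \<subseteq> V \<and> card S < d * (d + 1)"
    then have "connected_graph (V - S) (delete_vertices S E)"
      using assms(3) by (simp add: k_connected_def)
    moreover have "{(a, b). {a, b} \<in> delete_vertices S E}\<^sup>* \<subseteq> {(a, b). {a, b} \<in> delete_vertices S F}\<^sup>*"
      using EF by (intro rtrancl_mono) (auto simp: delete_vertices_def)
    ultimately show "connected_graph (V - S) (delete_vertices S F)"
      unfolding connected_graph_def by blast
  qed
  ultimately have "complete_edges V \<subseteq> F"
    using assms(1) by (intro closed_k_connected_complete[OF gen fin]) auto
  then show "matroid_closure (complete_edges V) (cofactor_indep d p V) E = complete_edges V"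
    using matroid_rank_insert_spanned[OF fin EV] by (auto simp: matroid_closure_def F_def)
qed

end
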